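(* Let $\mathcal{A}$ be a unital $C^*$-algebra of operators acting on a Hilbert space $\mathcal{H}$, with unit $1$, norm $\|\cdot\|$, multiplication $(a,b)\mapsto ab$ and involution $a\mapsto a^*$. Suppose that there exist a multiplication $\circ$ and an involution $\star$ on the normed space $(\mathcal{A},\|\cdot\|)$ making it into a $C^*$-algebra (with the same vector space structure and the same norm $\|\cdot\|$). Then there exist a unitary element $u\in\mathcal{A}$ (unitary with respect to the original structure) and a central projection $p$ in the double commutant $\mathcal{A}^{cc}$ of $\mathcal{A}$ such that $$a\circ b = p\,a\,u\,b + (1-p)\,b\,u\,a \quad\text{and}\quad a^\star = u^*a^*u^* \qquad\text{for all } a,b\in\mathcal{A}.$$
   Context: For a set $\mathcal{S}\subseteq\mathbb{B}(\mathcal{H})$, its commutant is $\mathcal{S}^{c}=\{B\in\mathbb{B}(\mathcal{H}) : AB=BA \text{ for all } A\in\mathcal{S}\}$, and $\mathcal{A}^{cc}=(\mathcal{A}^c)^c$ is the double commutant of $\mathcal{A}$. A central projection in $\mathcal{A}^{cc}$ is a self-adjoint idempotent $p\in\mathcal{A}^{cc}$ commuting with all elements of $\mathcal{A}^{cc}$. A $C^*$-algebra is a complex Banach $*$-algebra satisfying $\|a^*a\|=\|a\|^2$ for all $a$. The products on the right-hand sides of the displayed formulas are taken in the original multiplication of $\mathbb{B}(\mathcal{H})$. The $C^*$-algebra structure given by $\circ,\star$ is not assumed to be unital. *)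

theory Defs
  imports "HOL-Analysis.Analysis"
begin

text \<open>
  Complex Hilbert spaces. The inner product is linear in the second argument. Positivity and
  definiteness of the inner product follow from \<open>cinner_self\<close> and the norm axioms, and
  completeness is part of \<^class>\<open>banach\<close>.
\<close>

class complex_hilbert_space = banach +
  fixes scaleC :: "complex \<Rightarrow> 'a \<Rightarrow> 'a" (infixr "*\<^sub>C" 75)
    and cinner :: "'a \<Rightarrow> 'a \<Rightarrow> complex"
  assumes scaleC_add_right: "c *\<^sub>C (x + y) = c *\<^sub>C x + c *\<^sub>C y"
    and scaleC_add_left: "(c + d) *\<^sub>C x = c *\<^sub>C x + d *\<^sub>C x"
    and scaleC_scaleC: "c *\<^sub>C d *\<^sub>C x = (c * d) *\<^sub>C x"
    and scaleC_of_real: "complex_of_real r *\<^sub>C x = r *\<^sub>R x"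
    and cinner_add_right: "cinner x (y + z) = cinner x y + cinner x z"
    and cinner_scaleC_right: "cinner x (c *\<^sub>C y) = c * cinner x y"
    and cinner_commute: "cinner x y = cnj (cinner y x)"
    and cinner_self: "cinner x x = complex_of_real ((norm x)\<^sup>2)"
begin

lemma cinner_scaleC_left: "cinner (c *\<^sub>C x) y = cnj c * cinner x y"
  by (metis cinner_commute cinner_scaleC_right complex_cnj_mult)

lemma norm_scaleC: "norm (c *\<^sub>C x) = cmod c * norm x"
proof -
  have "complex_of_real ((norm (c *\<^sub>C x))\<^sup>2) = (c * cnj c) * complex_of_real ((norm x)\<^sup>2)"
    by (simp only: cinner_self[symmetric] cinner_scaleC_left cinner_scaleC_right mult.assoc)
  also have "\<dots> = complex_of_real ((cmod c * norm x)\<^sup>2)"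
    by (simp add: complex_norm_square[symmetric] power_mult_distrib)
  finally have "(norm (c *\<^sub>C x))\<^sup>2 = (cmod c * norm x)\<^sup>2"
    by (simp only: of_real_eq_iff)
  then show ?thesis
    by simp
qed

end

text \<open>
  Elements of the type \<open>'h \<Rightarrow>\<^sub>L 'h\<close> are only real-linear, so the algebra of all bounded operators
  on the complex Hilbert space is the subset of the complex-linear ones. The norm of
  \<open>'h \<Rightarrow>\<^sub>L 'h\<close> is the operator norm.
\<close>

definition bounded_operators :: "('h::complex_hilbert_space \<Rightarrow>\<^sub>L 'h) set" where
  "bounded_operators = {T. \<forall>c x. blinfun_apply T (c *\<^sub>C x) = c *\<^sub>C blinfun_apply T x}"

definition op_scale ::
    "complex \<Rightarrow> ('h::complex_hilbert_space \<Rightarrow>\<^sub>L 'h) \<Rightarrow> ('h \<Rightarrow>\<^sub>L 'h)" where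
  "op_scale c T = Blinfun (\<lambda>x. c *\<^sub>C blinfun_apply T x)"

lemma op_scale_apply: "blinfun_apply (op_scale c T) x = c *\<^sub>C blinfun_apply T x"
proof -
  have scaleR: "c *\<^sub>C r *\<^sub>R y = r *\<^sub>R c *\<^sub>C y" for r and y :: 'a
    by (simp add: scaleC_of_real[symmetric] scaleC_scaleC mult.commute)
  have "bounded_linear (\<lambda>y::'a. c *\<^sub>C y)"
    by (rule bounded_linear_intro[where K = "cmod c"])
      (auto simp: scaleC_add_right scaleR norm_scaleC mult.commute)
  then have "bounded_linear (\<lambda>x. c *\<^sub>C blinfun_apply T x)"
    by (rule bounded_linear_compose) (rule blinfun.bounded_linear_right)
  then show ?thesis
    by (simp add: op_scale_def bounded_linear_Blinfun_apply)
qed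

text \<open>
  The Hilbert space adjoint; existence and uniqueness for elements of \<^const>\<open>bounded_operators\<close>
  is the Riesz representation theorem.
\<close>

definition adjoint_op :: "('h::complex_hilbert_space \<Rightarrow>\<^sub>L 'h) \<Rightarrow> ('h \<Rightarrow>\<^sub>L 'h)" where
  "adjoint_op T = (THE S. \<forall>x y. cinner (blinfun_apply T x) y = cinner x (blinfun_apply S y))"

definition commutant ::
    "('h::complex_hilbert_space \<Rightarrow>\<^sub>L 'h) set \<Rightarrow> ('h \<Rightarrow>\<^sub>L 'h) set" where
  "commutant S = {B \<in> bounded_operators. \<forall>T\<in>S. T o\<^sub>L B = B o\<^sub>L T}"

definition central_projection ::
    "('h::complex_hilbert_space \<Rightarrow>\<^sub>L 'h) set \<Rightarrow> ('h \<Rightarrow>\<^sub>L 'h) \<Rightarrow> bool" where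
  "central_projection M p \<longleftrightarrow>
     p \<in> M \<and> adjoint_op p = p \<and> p o\<^sub>L p = p \<and> (\<forall>b\<in>M. p o\<^sub>L b = b o\<^sub>L p)"

text \<open>
  A (not necessarily unital) \<open>C\<^sup>*\<close>-algebra whose underlying normed space is a subset \<open>A\<close> of a
  real normed space, with addition and norm inherited, and with complex scalar multiplication,
  product and involution given by functions that matter only on \<open>A\<close>.
\<close>

locale cstar_algebra_on =
  fixes A :: "'b::real_normed_vector set"
    and smul :: "complex \<Rightarrow> 'b \<Rightarrow> 'b"
    and mul :: "'b \<Rightarrow> 'b \<Rightarrow> 'b"
    and star :: "'b \<Rightarrow> 'b"
  assumes zero_closed: "0 \<in> A"
    and add_closed: "\<And>a b. a \<in> A \<Longrightarrow> b \<in> A \<Longrightarrow> a + b \<in> A"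
    and smul_closed: "\<And>c a. a \<in> A \<Longrightarrow> smul c a \<in> A"
    and smul_add_right: "\<And>c a b. a \<in> A \<Longrightarrow> b \<in> A \<Longrightarrow> smul c (a + b) = smul c a + smul c b"
    and smul_add_left: "\<And>c d a. a \<in> A \<Longrightarrow> smul (c + d) a = smul c a + smul d a"
    and smul_smul: "\<And>c d a. a \<in> A \<Longrightarrow> smul c (smul d a) = smul (c * d) a"
    and smul_of_real: "\<And>r a. a \<in> A \<Longrightarrow> smul (complex_of_real r) a = r *\<^sub>R a"
    and norm_smul: "\<And>c a. a \<in> A \<Longrightarrow> norm (smul c a) = cmod c * norm a"
    and complete_carrier: "complete A"
    and mul_closed: "\<And>a b. a \<in> A \<Longrightarrow> b \<in> A \<Longrightarrow> mul a b \<in> A"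
    and mul_assoc: "\<And>a b c. a \<in> A \<Longrightarrow> b \<in> A \<Longrightarrow> c \<in> A \<Longrightarrow> mul (mul a b) c = mul a (mul b c)"
    and mul_add_left:
      "\<And>a b c. a \<in> A \<Longrightarrow> b \<in> A \<Longrightarrow> c \<in> A \<Longrightarrow> mul (a + b) c = mul a c + mul b c"
    and mul_add_right:
      "\<And>a b c. a \<in> A \<Longrightarrow> b \<in> A \<Longrightarrow> c \<in> A \<Longrightarrow> mul a (b + c) = mul a b + mul a c"
    and mul_smul_left: "\<And>c a b. a \<in> A \<Longrightarrow> b \<in> A \<Longrightarrow> mul (smul c a) b = smul c (mul a b)"
    and mul_smul_right: "\<And>c a b. a \<in> A \<Longrightarrow> b \<in> A \<Longrightarrow> mul a (smul c b) = smul c (mul a b)"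
    and norm_mul_le: "\<And>a b. a \<in> A \<Longrightarrow> b \<in> A \<Longrightarrow> norm (mul a b) \<le> norm a * norm b"
    and star_closed: "\<And>a. a \<in> A \<Longrightarrow> star a \<in> A"
    and star_star: "\<And>a. a \<in> A \<Longrightarrow> star (star a) = a"
    and star_add: "\<And>a b. a \<in> A \<Longrightarrow> b \<in> A \<Longrightarrow> star (a + b) = star a + star b"
    and star_smul: "\<And>c a. a \<in> A \<Longrightarrow> star (smul c a) = smul (cnj c) (star a)"
    and star_mul: "\<And>a b. a \<in> A \<Longrightarrow> b \<in> A \<Longrightarrow> star (mul a b) = mul (star b) (star a)"
    and cstar_identity: "\<And>a. a \<in> A \<Longrightarrow> norm (mul (star a) a) = (norm a)\<^sup>2"

text \<open>
  The unit \<open>e\<close> of the operator algebra \<open>A\<close> is not required to be the identity operator of the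
  Hilbert space.
\<close>

definition unital_operator_algebra ::
    "('h::complex_hilbert_space \<Rightarrow>\<^sub>L 'h) set \<Rightarrow> ('h \<Rightarrow>\<^sub>L 'h) \<Rightarrow> bool" where
  "unital_operator_algebra A e \<longleftrightarrow>
     A \<subseteq> bounded_operators \<and>
     cstar_algebra_on A op_scale (o\<^sub>L) adjoint_op \<and>
     e \<in> A \<and> (\<forall>a\<in>A. e o\<^sub>L a = a \<and> a o\<^sub>L e = a)"

end

theory Submission
  imports Defs
begin

text \<open>
  Write \<open>\<odot>\<close> and \<open>star\<close> for the second structure and \<open>e\<close> for the unit of \<open>A\<close>. For operators, being
  self-adjoint and inequalities between quadratic forms can be read off from norms of elements close
  to \<open>e\<close>, and these norms can be computed in either structure by its \<open>C\<^sup>*\<close>-identity. This gives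
  \<open>b \<odot> (star e \<odot> e) = (e \<odot> star e) \<odot> b\<close>, then that \<open>e \<odot> star e\<close> is a unit for \<open>\<odot>\<close>, so that \<open>e\<close> is
  unitary in the second structure.

  The isotope \<open>a \<odot> star e \<odot> b\<close> is therefore a third \<open>C\<^sup>*\<close>-structure, with the same unit \<open>e\<close> as the
  original one. Kadison's inequality \<open>s\<^sup>2 \<le> s \<odot> s\<close> for self-adjoint \<open>s\<close>, used in both directions, shows
  that two structures with a common unit have the same involution and the same Jordan product. By
  Herstein's identity the defects \<open>D a b = a \<odot> b - a b\<close> and \<open>E c d = c \<odot> d - d c\<close> satisfy
  \<open>E c d x D a b = 0\<close>; projecting onto the common kernel of all \<open>E c d x\<close> separates the homomorphic
  part of the product from the antihomomorphic part. Finally \<open>u\<close> is the adjoint of the unit of \<open>\<odot>\<close>.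
\<close>

section \<open>Complex Hilbert spaces\<close>

lemma cinner_add_left:
  fixes x y z :: "'a::complex_hilbert_space"
  shows "cinner (x + y) z = cinner x z + cinner y z"
  by (metis cinner_add_right cinner_commute complex_cnj_add)

lemma cinner_scaleR_right:
  fixes x y :: "'a::complex_hilbert_space"
  shows "cinner x (r *\<^sub>R y) = r *\<^sub>R cinner x y"
  by (metis cinner_scaleC_right scaleC_of_real scaleR_conv_of_real)

lemma cinner_scaleR_left:
  fixes x y :: "'a::complex_hilbert_space"
  shows "cinner (r *\<^sub>R x) y = r *\<^sub>R cinner x y"
  by (metis cinner_scaleC_left complex_cnj_complex_of_real scaleC_of_real scaleR_conv_of_real)

lemma norm_add_square:
  fixes x y :: "'a::complex_hilbert_space"
  shows "(norm (x + y))\<^sup>2 = (norm x)\<^sup>2 + (norm y)\<^sup>2 + 2 * Re (cinner x y)"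
proof -
  have "complex_of_real ((norm (x + y))\<^sup>2) = cinner (x + y) (x + y)"
    by (simp add: cinner_self)
  also have "\<dots> = cinner x x + cinner y y + (cinner x y + cnj (cinner x y))"
    by (simp add: cinner_add_left cinner_add_right cinner_commute[symmetric])
  finally show ?thesis
    by (simp only: cinner_self complex_add_cnj of_real_add[symmetric] of_real_eq_iff)
qed

lemma Cauchy_Schwarz_cinner:
  fixes x y :: "'a::complex_hilbert_space"
  shows "cmod (cinner x y) \<le> norm x * norm y"
proof (cases "y = 0")
  case True
  have "cinner x (0 *\<^sub>R y) = 0"
    by (simp only: cinner_scaleR_right) simp
  then show ?thesis using True by simp
next
  case False
  define c where "c = - (cinner y x / (norm y)\<^sup>2)"
  have "(norm (x + c *\<^sub>C y))\<^sup>2 = (norm x)\<^sup>2 + (cmod c * norm y)\<^sup>2 + 2 * Re (c * cinner x y)"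
    by (simp add: norm_add_square norm_scaleC cinner_scaleC_right)
  moreover have "c * cinner x y = - complex_of_real ((cmod (cinner x y))\<^sup>2 / (norm y)\<^sup>2)"
    unfolding of_real_divide complex_norm_square
    by (simp add: c_def cinner_commute[of y x] mult.commute)
  moreover have "cmod c * norm y = cmod (cinner x y) / norm y"
    using False by (simp add: c_def norm_divide norm_mult cinner_commute[of y x] power2_eq_square)
  ultimately have "0 \<le> (norm x)\<^sup>2 - (cmod (cinner x y))\<^sup>2 / (norm y)\<^sup>2"
    using zero_le_power2[of "norm (x + c *\<^sub>C y)"]
    by (simp only: uminus_complex.sel Re_complex_of_real power_divide)
  then have "(cmod (cinner x y))\<^sup>2 \<le> (norm x * norm y)\<^sup>2"
    using False by (simp add: field_simps)
  then show ?thesis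
    by (rule power2_le_imp_le) simp
qed

lemma bounded_bilinear_cinner:
  "bounded_bilinear (cinner :: 'a::complex_hilbert_space \<Rightarrow> 'a \<Rightarrow> complex)"
  by (rule bounded_bilinear.intro)
    (use Cauchy_Schwarz_cinner in \<open>auto simp: cinner_add_left cinner_add_right
      cinner_scaleR_left cinner_scaleR_right intro!: exI[of _ 1]\<close>)

interpretation cinner: bounded_bilinear "cinner :: 'a::complex_hilbert_space \<Rightarrow> 'a \<Rightarrow> complex"
  by (rule bounded_bilinear_cinner)

lemma scaleC_minus_right: "c *\<^sub>C (- x) = - (c *\<^sub>C (x::'a::complex_hilbert_space))"
proof -
  have "c *\<^sub>C ((-1) *\<^sub>R x) = (-1) *\<^sub>R (c *\<^sub>C x)"
    by (simp only: scaleC_of_real[symmetric] scaleC_scaleC mult.commute)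
  then show ?thesis by simp
qed

lemma scaleC_diff_right: "c *\<^sub>C (x - y) = c *\<^sub>C x - c *\<^sub>C (y::'a::complex_hilbert_space)"
  by (metis diff_conv_add_uminus scaleC_add_right scaleC_minus_right)

lemma scaleC_scaleR: "c *\<^sub>C r *\<^sub>R x = r *\<^sub>R c *\<^sub>C (x::'a::complex_hilbert_space)"
  by (simp add: scaleC_of_real[symmetric] scaleC_scaleC mult.commute)

lemma cinner_self_eq_0: "cinner x x = 0 \<longleftrightarrow> x = (0::'a::complex_hilbert_space)"
  by (simp add: cinner_self)

lemma Re_cinner_self: "Re (cinner x x) = (norm (x::'a::complex_hilbert_space))\<^sup>2"
  by (simp add: cinner_self)

lemma cinner_eq_iff: "(\<forall>z. cinner z x = cinner z y) \<longleftrightarrow> x = (y::'a::complex_hilbert_space)"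
  by (metis cinner.diff_right cinner_self_eq_0 right_minus_eq)

lemma norm_diff_square:
  fixes x y :: "'a::complex_hilbert_space"
  shows "(norm (x - y))\<^sup>2 = (norm x)\<^sup>2 + (norm y)\<^sup>2 - 2 * Re (cinner x y)"
  using norm_add_square[of x "- y"] by (simp add: cinner.minus_right)

text \<open>Isolates first-order terms in perturbation arguments: a \<open>t\<close> of sign
  opposite to \<open>\<alpha>\<close> and of size
  \<open>\<bar>\<alpha>\<bar> / (\<bar>\<beta>\<bar> + 1)\<close> lets the linear term outweigh the
  quadratic one.\<close>

lemma linear_coefficient_zero:
  fixes \<alpha> \<beta> :: real
  assumes "\<And>t. 0 \<le> \<alpha> * t + \<beta> * t\<^sup>2"
  shows "\<alpha> = 0"
proof (rule ccontr)
  assume "\<alpha> \<noteq> 0"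
  define t where "t = - \<alpha> / (\<bar>\<beta>\<bar> + 1)"
  have "\<alpha> * t + \<beta> * t\<^sup>2 = \<alpha>\<^sup>2 * (\<beta> - (\<bar>\<beta>\<bar> + 1)) / (\<bar>\<beta>\<bar> + 1)\<^sup>2"
    unfolding t_def by (simp add: divide_simps) (simp add: algebra_simps power2_eq_square)
  moreover have "\<alpha>\<^sup>2 * (\<beta> - (\<bar>\<beta>\<bar> + 1)) / (\<bar>\<beta>\<bar> + 1)\<^sup>2 < 0"
    using \<open>\<alpha> \<noteq> 0\<close> by (intro divide_neg_pos mult_pos_neg) (auto simp: add_pos_nonneg)
  ultimately show False
    using assms[of t] by linarith
qed

lemma nonpos_if_le_small:
  fixes X K :: real
  assumes "\<And>t. 0 < t \<Longrightarrow> t \<le> \<delta> \<Longrightarrow> X \<le> K * t" and "0 < \<delta>"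
  shows "X \<le> 0"
proof (rule ccontr)
  assume X: "\<not> X \<le> 0"
  define t where "t = min \<delta> (X / (2 * (\<bar>K\<bar> + 1)))"
  have "0 < t" "t \<le> \<delta>" and t: "t \<le> X / (2 * (\<bar>K\<bar> + 1))"
    using X assms(2) by (auto simp: t_def)
  then have "X \<le> K * t" using assms(1) by blast
  also have "\<dots> \<le> \<bar>K\<bar> * t" using \<open>0 < t\<close> by (simp add: mult_right_mono)
  also have "\<dots> \<le> (\<bar>K\<bar> + 1) * t" using \<open>0 < t\<close> by (simp add: mult_right_mono)
  also have "\<dots> \<le> X / 2" using t by (simp add: field_simps)
  finally show False using X by simp
qed

subsection \<open>Orthogonal projections and adjoints\<close>

locale closed_csubspace =
  fixes M :: "'a::complex_hilbert_space set"
  assumes closed: "closed M" and zero: "0 \<in> M"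
    and add: "\<And>x y. x \<in> M \<Longrightarrow> y \<in> M \<Longrightarrow> x + y \<in> M"
    and scaleC: "\<And>c x. x \<in> M \<Longrightarrow> c *\<^sub>C x \<in> M"
begin

lemma scaleR: "x \<in> M \<Longrightarrow> r *\<^sub>R x \<in> M"
  by (metis scaleC scaleC_of_real)

lemma diff: "x \<in> M \<Longrightarrow> y \<in> M \<Longrightarrow> x - y \<in> M"
  using add[of x "(-1) *\<^sub>R y"] scaleR[of y "-1"] by simp

text \<open>Parallelogram law for \<open>x - m\<close> and \<open>x - m'\<close>: the midpoint of
  \<open>m\<close> and \<open>m'\<close> lies in \<open>M\<close>, hence at distance at least
  \<open>infdist x M\<close> from \<open>x\<close>.\<close>

lemma midpoint_bound:
  assumes "m \<in> M" "m' \<in> M"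
  shows "(norm (m - m'))\<^sup>2 \<le> 2 * (dist x m)\<^sup>2 + 2 * (dist x m')\<^sup>2 - 4 * (infdist x M)\<^sup>2"
proof -
  have "(1/2) *\<^sub>R (m + m') \<in> M"
    using assms by (intro scaleR add)
  then have "infdist x M \<le> dist x ((1/2) *\<^sub>R (m + m'))"
    by (rule infdist_le)
  also have "\<dots> = norm ((x - m) + (x - m')) / 2"
  proof -
    have "x - (1/2) *\<^sub>R (m + m') = (1/2) *\<^sub>R ((x - m) + (x - m'))"
      by (simp add: algebra_simps flip: scaleR_add_left)
    then show ?thesis by (simp add: dist_norm)
  qed
  finally have "(infdist x M)\<^sup>2 \<le> (norm ((x - m) + (x - m')) / 2)\<^sup>2"
    by (rule power_mono) (rule infdist_nonneg)
  then have "4 * (infdist x M)\<^sup>2 \<le> (norm ((x - m) + (x - m')))\<^sup>2"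
    by (simp add: power_divide)
  moreover have "(norm (m - m'))\<^sup>2 = (norm ((x - m) - (x - m')))\<^sup>2"
    by (simp add: norm_minus_commute)
  ultimately show ?thesis
    unfolding dist_norm using norm_add_square[of "x - m" "x - m'"] norm_diff_square[of "x - m" "x - m'"]
    by linarith
qed

text \<open>By \<open>midpoint_bound\<close> a minimizing sequence is Cauchy, and its limit stays in
  the closed set \<open>M\<close>.\<close>

lemma nearest_point: "\<exists>k\<in>M. dist x k = infdist x M"
proof -
  let ?d = "infdist x M"
  have "\<exists>m\<in>M. (dist x m)\<^sup>2 < ?d\<^sup>2 + 1 / real (Suc n)" for n
  proof -
    have "?d < sqrt (?d\<^sup>2 + 1 / real (Suc n))"
      by (rule real_less_rsqrt) simp
    then obtain m where m: "m \<in> M" "dist x m < sqrt (?d\<^sup>2 + 1 / real (Suc n))"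
      using zero cINF_less_iff[OF _ bdd_below_image_dist] by (metis empty_iff infdist_notempty)
    then have "(dist x m)\<^sup>2 < (sqrt (?d\<^sup>2 + 1 / real (Suc n)))\<^sup>2"
      by (intro power_strict_mono) auto
    also have "\<dots> = ?d\<^sup>2 + 1 / real (Suc n)"
      by (intro real_sqrt_pow2 add_nonneg_nonneg) auto
    finally show ?thesis using m(1) by blast
  qed
  then obtain m where m: "\<And>n. m n \<in> M" "\<And>n. (dist x (m n))\<^sup>2 < ?d\<^sup>2 + 1 / real (Suc n)"
    by metis
  have "Cauchy m"
  proof (rule metric_CauchyI)
    fix \<epsilon> :: real assume "0 < \<epsilon>"
    then obtain N where N: "1 / real (Suc N) < \<epsilon>\<^sup>2 / 4"
      by (meson nat_approx_posE divide_pos_pos zero_less_numeral zero_less_power)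
    have "dist (m i) (m j) < \<epsilon>" if "N \<le> i" "N \<le> j" for i j
    proof -
      have le: "1 / real (Suc i) \<le> 1 / real (Suc N)" "1 / real (Suc j) \<le> 1 / real (Suc N)"
        using that by (auto simp: frac_le)
      have "(dist (m i) (m j))\<^sup>2 < \<epsilon>\<^sup>2"
        using midpoint_bound[OF m(1)[of i] m(1)[of j], of x] m(2)[of i] m(2)[of j] le N
        unfolding dist_norm by linarith
      then show ?thesis
        using \<open>0 < \<epsilon>\<close> by (simp add: power2_less_imp_less)
    qed
    then show "\<exists>N. \<forall>i\<ge>N. \<forall>j\<ge>N. dist (m i) (m j) < \<epsilon>" by blast
  qed
  then obtain k where k: "m \<longlonglongrightarrow> k"
    using Cauchy_convergent convergent_def by blast
  have "k \<in> M"
    using closed_sequentially[OF closed _ k] m(1) by blast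
  have "(\<lambda>n. (dist x (m n))\<^sup>2) \<longlonglongrightarrow> (dist x k)\<^sup>2"
    by (intro tendsto_intros k)
  moreover have "(\<lambda>n. ?d\<^sup>2 + 1 / real (Suc n)) \<longlonglongrightarrow> ?d\<^sup>2 + 0"
    by (intro tendsto_add tendsto_const LIMSEQ_Suc lim_1_over_n)
  ultimately have "(dist x k)\<^sup>2 \<le> ?d\<^sup>2 + 0"
    by (rule LIMSEQ_le) (use m(2) less_imp_le in blast)
  then have "dist x k \<le> ?d"
    using infdist_nonneg power2_le_imp_le by fastforce
  with infdist_le[OF \<open>k \<in> M\<close>, of x] \<open>k \<in> M\<close> show ?thesis by force
qed

text \<open>Moving the nearest point \<open>k\<close> by a multiple of \<open>m\<close> cannot
  shorten the distance, so the term linear in \<open>t\<close> vanishes. This settles the real part;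
  \<open>\<i> *\<^sub>C m\<close> in place of \<open>m\<close> settles the imaginary part.\<close>

lemma orthogonal_decomposition: "\<exists>k\<in>M. \<forall>m\<in>M. cinner m (x - k) = 0"
proof -
  obtain k where k: "k \<in> M" "dist x k = infdist x M"
    using nearest_point by blast
  have Re0: "Re (cinner m (x - k)) = 0" if "m \<in> M" for m
  proof -
    have "0 \<le> (2 * Re (cinner m (x - k))) * t + (norm m)\<^sup>2 * t\<^sup>2" for t
    proof -
      have "k - t *\<^sub>R m \<in> M" using k that by (intro diff scaleR)
      from infdist_le[OF this, of x] have "(norm (x - k))\<^sup>2 \<le> (norm (x - (k - t *\<^sub>R m)))\<^sup>2"
        unfolding k(2)[symmetric] by (simp add: dist_norm power_mono)
      also have "x - (k - t *\<^sub>R m) = t *\<^sub>R m + (x - k)" by simp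
      finally show ?thesis
        unfolding norm_add_square
        by (simp add: cinner_scaleR_left power_mult_distrib algebra_simps)
    qed
    from linear_coefficient_zero[OF this] show ?thesis by simp
  qed
  moreover have "Im (cinner m (x - k)) = 0" if "m \<in> M" for m
    using Re0[OF scaleC[OF that, of "\<i>"]] by (simp add: cinner_scaleC_left)
  ultimately show ?thesis
    using k(1) by (metis complex_eqI zero_complex.sel)
qed

end

subsection \<open>Bounded operators\<close>

lemmas blinfun_simps = blinfun.add_left blinfun.add_right blinfun.diff_left blinfun.diff_right
  blinfun.minus_left blinfun.minus_right blinfun.scaleR_left blinfun.scaleR_right
  blinfun.zero_left blinfun.zero_right

lemma bounded_operatorsD:
  "T \<in> bounded_operators \<Longrightarrow> blinfun_apply T (c *\<^sub>C x) = c *\<^sub>C blinfun_apply T x"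
  by (simp add: bounded_operators_def)

lemma id_in_bounded_operators: "id_blinfun \<in> bounded_operators"
  by (simp add: bounded_operators_def)

lemma diff_in_bounded_operators:
  "S \<in> bounded_operators \<Longrightarrow> T \<in> bounded_operators \<Longrightarrow> S - T \<in> bounded_operators"
  by (simp add: bounded_operators_def blinfun_simps scaleC_diff_right)

lemma ortho_cinner_zero:
  fixes x y :: "'a::complex_hilbert_space"
  shows "cinner x y = 0 \<longleftrightarrow> cinner y x = 0"
  by (metis cinner_commute complex_cnj_zero)

text \<open>A vector \<open>w\<close> orthogonal to the kernel determines \<open>f\<close>:
  subtracting a suitable multiple of \<open>w\<close> moves any \<open>x\<close> into the kernel.
  The representing vector is \<open>w\<close> rescaled.\<close>

lemma Riesz_representation:
  fixes f :: "'a::complex_hilbert_space \<Rightarrow> complex"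
  assumes f: "bounded_linear f" and scale: "\<And>c x. f (c *\<^sub>C x) = c * f x"
  shows "\<exists>z. \<forall>x. f x = cinner z x"
proof (cases "\<forall>x. f x = 0")
  case True
  then show ?thesis by (auto intro!: exI[of _ 0] simp: cinner.zero_left)
next
  case False
  then obtain v where v: "f v \<noteq> 0" by blast
  interpret f: bounded_linear f by (rule f)
  interpret closed_csubspace "{x. f x = 0}"
  proof
    show "closed {x. f x = 0}"
      by (intro closed_Collect_eq f.continuous_on continuous_intros)
  qed (auto simp: f.zero f.add scale)
  obtain k where k: "f k = 0" and orth: "\<And>m. f m = 0 \<Longrightarrow> cinner m (v - k) = 0"
    using orthogonal_decomposition[of v] by auto
  define w where "w = v - k"
  have fw: "f w \<noteq> 0"
    using v k by (simp add: w_def f.diff)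
  then have w: "cinner w w \<noteq> 0"
    by (metis cinner_self_eq_0 f.zero)
  define z where "z = cnj (f w / cinner w w) *\<^sub>C w"
  have "f x = cinner z x" for x
  proof -
    have "f (x - (f x / f w) *\<^sub>C w) = 0"
      using fw by (simp add: f.diff scale)
    then have "cinner (x - (f x / f w) *\<^sub>C w) w = 0"
      using orth w_def by blast
    then have "cinner w (x - (f x / f w) *\<^sub>C w) = 0"
      using ortho_cinner_zero by blast
    then have "cinner w x = f x / f w * cinner w w"
      by (simp add: cinner.diff_right cinner_scaleC_right)
    then show ?thesis
      using fw w by (simp add: z_def cinner_scaleC_left)
  qed
  then show ?thesis by blast
qed

lemma adjoint_opI:
  fixes T S :: "'a::complex_hilbert_space \<Rightarrow>\<^sub>L 'a"
  assumes "\<And>x y. cinner (blinfun_apply T x) y = cinner x (blinfun_apply S y)"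
  shows "adjoint_op T = S"
  unfolding adjoint_op_def
proof (rule the_equality)
  fix R :: "'a \<Rightarrow>\<^sub>L 'a"
  assume R: "\<forall>x y. cinner (blinfun_apply T x) y = cinner x (blinfun_apply R y)"
  show "R = S"
  proof (rule blinfun_eqI)
    fix y
    have "\<forall>z. cinner z (blinfun_apply R y) = cinner z (blinfun_apply S y)"
      by (simp only: R[rule_format, symmetric] assms[symmetric] simp_thms)
    then show "blinfun_apply R y = blinfun_apply S y"
      by (simp only: cinner_eq_iff)
  qed
next
  show "\<forall>x y. cinner (blinfun_apply T x) y = cinner x (blinfun_apply S y)"
    by (intro allI assms)
qed

text \<open>Riesz representation defines the adjoint pointwise; testing it on \<open>g y\<close> and
  applying Cauchy-Schwarz bounds its norm.\<close>

lemma adjoint_exists: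
  fixes T :: "'a::complex_hilbert_space \<Rightarrow>\<^sub>L 'a"
  assumes T: "T \<in> bounded_operators"
  shows "\<exists>S\<in>bounded_operators. \<forall>x y. cinner (blinfun_apply T x) y = cinner x (blinfun_apply S y)"
proof -
  have "\<exists>z. \<forall>x. cinner y (blinfun_apply T x) = cinner z x" for y
  proof (rule Riesz_representation)
    show "bounded_linear (\<lambda>x. cinner y (blinfun_apply T x))"
      by (intro bounded_linear_compose[OF cinner.bounded_linear_right] blinfun.bounded_linear_right)
  qed (simp add: bounded_operatorsD[OF T] cinner_scaleC_right)
  then obtain g where "\<And>y x. cinner y (blinfun_apply T x) = cinner (g y) x"
    by metis
  then have g: "cinner (blinfun_apply T x) y = cinner x (g y)" for x y
    by (metis cinner_commute)
  have lin: "g (x + y) = g x + g y" "g (c *\<^sub>C x) = c *\<^sub>C g x" for x y c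
    by (simp_all add: cinner_eq_iff[symmetric] g[symmetric] cinner_add_right cinner_scaleC_right)
  have scaleR: "g (r *\<^sub>R x) = r *\<^sub>R g x" for r x
    by (simp add: lin scaleC_of_real[symmetric])
  have "norm (g y) \<le> norm y * norm T" for y
  proof (cases "g y = 0")
    case False
    have "(norm (g y))\<^sup>2 = cmod (cinner (blinfun_apply T (g y)) y)"
      by (simp add: g cinner_self norm_power)
    also have "\<dots> \<le> norm (blinfun_apply T (g y)) * norm y"
      by (rule Cauchy_Schwarz_cinner)
    also have "\<dots> \<le> norm T * norm (g y) * norm y"
      by (intro mult_right_mono norm_blinfun) simp
    finally show ?thesis
      using False by (simp add: power2_eq_square mult.commute mult.left_commute)
  qed simp
  then have "bounded_linear g"
    by (intro bounded_linear_intro[where K = "norm T"] lin(1) scaleR)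
  then have "blinfun_apply (Blinfun g) = g"
    by (rule bounded_linear_Blinfun_apply)
  with g lin show ?thesis
    by (intro bexI[of _ "Blinfun g"]) (auto simp: bounded_operators_def)
qed

lemma
  fixes T :: "'a::complex_hilbert_space \<Rightarrow>\<^sub>L 'a"
  assumes T: "T \<in> bounded_operators"
  shows cinner_adjoint_right: "cinner x (blinfun_apply (adjoint_op T) y) = cinner (blinfun_apply T x) y"
    and cinner_adjoint_left: "cinner (blinfun_apply (adjoint_op T) x) y = cinner x (blinfun_apply T y)"
    and adjoint_in_bounded_operators: "adjoint_op T \<in> bounded_operators"
proof -
  obtain S where S: "S \<in> bounded_operators"
      "\<And>x y. cinner (blinfun_apply T x) y = cinner x (blinfun_apply S y)"
    using adjoint_exists[OF T] by blast
  moreover from S(2) have "adjoint_op T = S" by (rule adjoint_opI)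
  ultimately show *: "cinner x (blinfun_apply (adjoint_op T) y) = cinner (blinfun_apply T x) y"
    and "adjoint_op T \<in> bounded_operators" for x y
    by auto
  show "cinner (blinfun_apply (adjoint_op T) x) y = cinner x (blinfun_apply T y)"
    by (metis * cinner_commute)
qed

lemma adjoint_compose:
  "S \<in> bounded_operators \<Longrightarrow> T \<in> bounded_operators \<Longrightarrow>
    adjoint_op (S o\<^sub>L T) = adjoint_op T o\<^sub>L adjoint_op S"
  by (rule adjoint_opI) (simp add: cinner_adjoint_right)

text \<open>Complex polarization: the test vector \<open>x + y\<close> controls the imaginary parts
  of the off-diagonal entries, \<open>x + \<i> *\<^sub>C y\<close> the real parts.\<close>

lemma self_adjoint_if_real_form:
  fixes T :: "'a::complex_hilbert_space \<Rightarrow>\<^sub>L 'a"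
  assumes T: "T \<in> bounded_operators" and real: "\<And>x. Im (cinner x (blinfun_apply T x)) = 0"
  shows "adjoint_op T = T"
proof (rule adjoint_opI)
  fix x y
  have "Im (cinner x (blinfun_apply T y)) + Im (cinner y (blinfun_apply T x)) = 0"
    using real[of "x + y"] real[of x] real[of y]
    by (simp add: blinfun_simps cinner_add_left cinner_add_right)
  moreover have "Re (cinner x (blinfun_apply T y)) = Re (cinner y (blinfun_apply T x))"
    using real[of "x + \<i> *\<^sub>C y"] real[of x] real[of y]
    by (simp add: blinfun_simps cinner_add_left cinner_add_right bounded_operatorsD[OF T]
        cinner_scaleC_left cinner_scaleC_right)
  ultimately have "cnj (cinner y (blinfun_apply T x)) = cinner x (blinfun_apply T y)"
    by (simp add: complex_eq_iff)
  then show "cinner (blinfun_apply T x) y = cinner x (blinfun_apply T y)"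
    by (simp add: cinner_commute[symmetric])
qed

text \<open>Polarization and the parallelogram law, with \<open>T x\<close> rescaled to the length
  of \<open>x\<close> as second test vector.\<close>

lemma norm_le_if_form_bounded:
  fixes T :: "'a::complex_hilbert_space \<Rightarrow>\<^sub>L 'a"
  assumes sa: "\<And>x y. cinner (blinfun_apply T x) y = cinner x (blinfun_apply T y)"
    and "0 \<le> K" and bound: "\<And>x. \<bar>Re (cinner x (blinfun_apply T x))\<bar> \<le> K * (norm x)\<^sup>2"
  shows "norm T \<le> K"
proof (rule norm_blinfun_bound)
  fix x
  let ?T = "blinfun_apply T"
  show "norm (?T x) \<le> K * norm x"
  proof (cases "?T x = 0 \<or> x = 0")
    case True
    then show ?thesis using \<open>0 \<le> K\<close> by (auto simp: blinfun_simps)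
  next
    case False
    define y where "y = (norm x / norm (?T x)) *\<^sub>R ?T x"
    have "cinner x (?T y) = cinner (?T x) y"
      by (simp add: sa)
    also have "\<dots> = complex_of_real (norm x * norm (?T x))"
      using False by (simp add: y_def cinner.scaleR_right cinner_self scaleR_conv_of_real power2_eq_square)
    finally have xy: "Re (cinner x (?T y)) = norm x * norm (?T x)"
      by (metis Re_complex_of_real)
    have yx: "Re (cinner y (?T x)) = Re (cinner x (?T y))"
      by (subst cinner_commute) (simp add: sa)
    have ny: "norm y = norm x"
      using False by (simp add: y_def)
    have "4 * Re (cinner x (?T y)) = Re (cinner (x + y) (?T (x + y))) - Re (cinner (x - y) (?T (x - y)))"
      using yx by (simp add: blinfun_simps cinner.add_left cinner.add_right cinner.diff_left cinner.diff_right)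
    also have "\<dots> \<le> K * (norm (x + y))\<^sup>2 + K * (norm (x - y))\<^sup>2"
      using bound[of "x + y"] bound[of "x - y"] by linarith
    also have "\<dots> = K * ((norm (x + y))\<^sup>2 + (norm (x - y))\<^sup>2)"
      by (simp add: distrib_left)
    also have "\<dots> = K * (4 * (norm x)\<^sup>2)"
      by (simp add: norm_add_square norm_diff_square ny)
    finally have "norm x * norm (?T x) \<le> norm x * (K * norm x)"
      by (simp add: xy power2_eq_square algebra_simps)
    then show ?thesis using False by simp
  qed
qed (rule \<open>0 \<le> K\<close>)

context closed_csubspace
begin

text \<open>The point of \<open>M\<close> with orthogonal remainder is unique (\<open>uniq\<close>),
  which makes the choice function \<open>g\<close> linear; Pythagoras makes it contractive.\<close>

lemma projection_exists:
  "\<exists>r\<in>bounded_operators. adjoint_op r = r \<and> (\<forall>x. blinfun_apply r x \<in> M) \<and>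
    (\<forall>x\<in>M. blinfun_apply r x = x)"
proof -
  obtain g where gM: "\<And>x. g x \<in> M" and orth: "\<And>x m. m \<in> M \<Longrightarrow> cinner m (x - g x) = 0"
    using orthogonal_decomposition by metis
  have uniq: "g x = k" if "k \<in> M" and "\<And>m. m \<in> M \<Longrightarrow> cinner m (x - k) = 0" for x k
  proof -
    have gk: "g x - k \<in> M" using gM that(1) by (rule diff)
    have "cinner (g x - k) ((x - k) - (x - g x)) = 0"
      by (subst cinner.diff_right) (simp only: orth[OF gk] that(2)[OF gk] diff_self)
    then show ?thesis by (simp add: cinner_self)
  qed
  have add': "g (x + y) = g x + g y" for x y
  proof (rule uniq)
    fix m assume m: "m \<in> M"
    have "x + y - (g x + g y) = (x - g x) + (y - g y)"
      by simp
    then show "cinner m (x + y - (g x + g y)) = 0"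
      by (simp only: cinner_add_right orth[OF m] add_0)
  qed (intro add gM)
  have scaleC': "g (c *\<^sub>C x) = c *\<^sub>C g x" for c x
    by (rule uniq) (simp_all add: gM scaleC orth scaleC_diff_right[symmetric] cinner_scaleC_right)
  have scaleR': "g (r *\<^sub>R x) = r *\<^sub>R g x" for r x
    by (simp add: scaleC' scaleC_of_real[symmetric])
  have "norm (g x) \<le> norm x" for x
  proof -
    have "(norm (g x + (x - g x)))\<^sup>2 = (norm (g x))\<^sup>2 + (norm (x - g x))\<^sup>2"
      unfolding norm_add_square by (simp add: orth gM)
    then have "(norm (g x))\<^sup>2 \<le> (norm x)\<^sup>2" by simp
    then show ?thesis by (rule power2_le_imp_le) simp
  qed
  then have "bounded_linear g"
    by (intro bounded_linear_intro[where K = 1] add' scaleR') simp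
  then have app: "blinfun_apply (Blinfun g) = g"
    by (rule bounded_linear_Blinfun_apply)
  have "cinner (g x) y = cinner x (g y)" for x y
  proof -
    have "cinner (g x) y = cinner (g x) (g y)"
      using orth[OF gM, of x y] by (simp add: cinner.diff_right)
    also have "\<dots> = cinner x (g y)"
      using orth[OF gM, of y x] ortho_cinner_zero[of "g y" "x - g x"]
      by (simp add: cinner.diff_left)
    finally show ?thesis .
  qed
  then have "adjoint_op (Blinfun g) = Blinfun g"
    by (intro adjoint_opI) (simp add: app)
  moreover have "g x = x" if "x \<in> M" for x
    by (rule uniq) (simp_all add: that cinner.zero_right)
  moreover have "Blinfun g \<in> bounded_operators"
    by (simp add: bounded_operators_def app scaleC')
  ultimately show ?thesis
    using gM by (intro bexI[of _ "Blinfun g"]) (auto simp: app)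
qed

text \<open>Invariance of \<open>M\<close> under \<open>adjoint_op B\<close> means that
  \<open>B\<close> preserves the orthogonal complement of \<open>M\<close>, so the vector
  \<open>v\<close> projects to zero.\<close>

lemma projection_commute:
  assumes r: "r \<in> bounded_operators" "adjoint_op r = r" "\<And>x. blinfun_apply r x \<in> M"
      "\<And>x. x \<in> M \<Longrightarrow> blinfun_apply r x = x"
    and B: "B \<in> bounded_operators" "\<And>x. x \<in> M \<Longrightarrow> blinfun_apply B x \<in> M"
      "\<And>x. x \<in> M \<Longrightarrow> blinfun_apply (adjoint_op B) x \<in> M"
  shows "r o\<^sub>L B = B o\<^sub>L r"
proof (rule blinfun_eqI, simp)
  fix x
  define v where "v = blinfun_apply B (x - blinfun_apply r x)"
  have rr: "cinner (blinfun_apply r x) y = cinner x (blinfun_apply r y)" for x y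
    using cinner_adjoint_left[OF r(1)] r(2) by simp
  have orth: "cinner m (x - blinfun_apply r x) = 0" if "m \<in> M" for m
    using rr[of m x] r(4)[OF that] by (simp add: cinner.diff_right)
  have "cinner (blinfun_apply r v) (blinfun_apply r v) = cinner (blinfun_apply r v) v"
    using rr[of "blinfun_apply r v" v] r(4)[OF r(3)] by metis
  also have "\<dots> = cinner (blinfun_apply (adjoint_op B) (blinfun_apply r v)) (x - blinfun_apply r x)"
    unfolding v_def by (rule cinner_adjoint_left[OF B(1), symmetric])
  also have "\<dots> = 0"
    by (intro orth B(3) r(3))
  finally have "blinfun_apply r v = 0" by (simp only: cinner_self_eq_0)
  moreover have "blinfun_apply r (blinfun_apply B (blinfun_apply r x)) = blinfun_apply B (blinfun_apply r x)"
    by (rule r(4)[OF B(2)[OF r(3)]])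
  moreover have "blinfun_apply r v =
      blinfun_apply r (blinfun_apply B x) - blinfun_apply r (blinfun_apply B (blinfun_apply r x))"
    by (simp only: v_def blinfun.diff_right)
  ultimately show "blinfun_apply r (blinfun_apply B x) = blinfun_apply B (blinfun_apply r x)"
    by (simp only: right_minus_eq)
qed

end

section \<open>\<open>C\<^sup>*\<close>-structures on a space of operators\<close>

abbreviation ii :: "('h::complex_hilbert_space \<Rightarrow>\<^sub>L 'h) \<Rightarrow> ('h \<Rightarrow>\<^sub>L 'h)" where
  "ii \<equiv> op_scale \<i>"

lemma op_scale_add_right: "op_scale c (S + T) = op_scale c S + op_scale c T"
  by (rule blinfun_eqI) (simp add: op_scale_apply blinfun_simps scaleC_add_right)

lemma op_scale_diff_right: "op_scale c (S - T) = op_scale c S - op_scale c T"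
  by (rule blinfun_eqI) (simp add: op_scale_apply blinfun_simps scaleC_diff_right)

lemma op_scale_minus_right: "op_scale c (- T) = - op_scale c T"
  by (rule blinfun_eqI) (simp add: op_scale_apply blinfun_simps scaleC_minus_right)

lemma op_scale_scaleR: "op_scale c (r *\<^sub>R T) = r *\<^sub>R op_scale c T"
  by (rule blinfun_eqI) (simp add: op_scale_apply blinfun_simps scaleC_scaleR)

lemma op_scale_zero_right: "op_scale c 0 = 0"
  by (rule blinfun_eqI) (metis blinfun.zero_left op_scale_apply scaleC_diff_right right_minus_eq)

lemma op_scale_op_scale: "op_scale c (op_scale d T) = op_scale (c * d) T"
  by (rule blinfun_eqI) (simp add: op_scale_apply scaleC_scaleC)

lemma op_scale_of_real: "op_scale (complex_of_real r) T = r *\<^sub>R T"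
  by (rule blinfun_eqI) (simp add: op_scale_apply blinfun_simps scaleC_of_real)

lemma ii_ii: "ii (ii T) = - T"
  using op_scale_of_real[of "-1" T] by (simp add: op_scale_op_scale)

lemma ii_eq_iff: "ii S = ii T \<longleftrightarrow> S = T"
  by (metis ii_ii neg_equal_iff_equal)

lemmas ii_simps = op_scale_add_right op_scale_diff_right op_scale_minus_right op_scale_scaleR
  op_scale_zero_right ii_ii

locale cstar_structure = cstar_algebra_on A op_scale mul star
  for A :: "('h::complex_hilbert_space \<Rightarrow>\<^sub>L 'h) set"
    and mul :: "('h \<Rightarrow>\<^sub>L 'h) \<Rightarrow> ('h \<Rightarrow>\<^sub>L 'h) \<Rightarrow> ('h \<Rightarrow>\<^sub>L 'h)" (infixl "\<odot>" 70)
    and star :: "('h \<Rightarrow>\<^sub>L 'h) \<Rightarrow> ('h \<Rightarrow>\<^sub>L 'h)"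
begin

lemma scaleR_closed: "a \<in> A \<Longrightarrow> r *\<^sub>R a \<in> A"
  by (metis smul_closed op_scale_of_real)

lemma minus_closed: "a \<in> A \<Longrightarrow> - a \<in> A"
  using scaleR_closed[of a "-1"] by simp

lemma diff_closed: "a \<in> A \<Longrightarrow> b \<in> A \<Longrightarrow> a - b \<in> A"
  using add_closed[of a "- b"] minus_closed by simp

lemmas closed = add_closed smul_closed mul_closed star_closed scaleR_closed minus_closed diff_closed

lemma mul_scaleR_left: "a \<in> A \<Longrightarrow> b \<in> A \<Longrightarrow> (r *\<^sub>R a) \<odot> b = r *\<^sub>R (a \<odot> b)"
  by (simp add: op_scale_of_real[symmetric] mul_smul_left)

lemma mul_scaleR_right: "a \<in> A \<Longrightarrow> b \<in> A \<Longrightarrow> a \<odot> (r *\<^sub>R b) = r *\<^sub>R (a \<odot> b)"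
  by (simp add: op_scale_of_real[symmetric] mul_smul_right)

lemma mul_minus_left: "a \<in> A \<Longrightarrow> b \<in> A \<Longrightarrow> (- a) \<odot> b = - (a \<odot> b)"
  using mul_scaleR_left[of a b "-1"] by simp

lemma mul_minus_right: "a \<in> A \<Longrightarrow> b \<in> A \<Longrightarrow> a \<odot> (- b) = - (a \<odot> b)"
  using mul_scaleR_right[of a b "-1"] by simp

lemma mul_diff_left: "a \<in> A \<Longrightarrow> b \<in> A \<Longrightarrow> c \<in> A \<Longrightarrow> (a - b) \<odot> c = a \<odot> c - b \<odot> c"
  using mul_add_left[of a "- b" c] by (simp add: minus_closed mul_minus_left)

lemma mul_diff_right: "a \<in> A \<Longrightarrow> b \<in> A \<Longrightarrow> c \<in> A \<Longrightarrow> a \<odot> (b - c) = a \<odot> b - a \<odot> c"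
  using mul_add_right[of a b "- c"] by (simp add: minus_closed mul_minus_right)

lemma mul_zero_left: "a \<in> A \<Longrightarrow> 0 \<odot> a = 0"
  using mul_scaleR_left[of a a 0] by simp

lemma mul_zero_right: "a \<in> A \<Longrightarrow> a \<odot> 0 = 0"
  using mul_scaleR_right[of a a 0] by simp

lemma star_scaleR: "a \<in> A \<Longrightarrow> star (r *\<^sub>R a) = r *\<^sub>R star a"
  using star_smul[of a "complex_of_real r"] by (simp add: op_scale_of_real)

lemma star_minus: "a \<in> A \<Longrightarrow> star (- a) = - star a"
  using star_scaleR[of a "-1"] by simp

lemma star_diff: "a \<in> A \<Longrightarrow> b \<in> A \<Longrightarrow> star (a - b) = star a - star b"
  using star_add[of a "- b"] by (simp add: minus_closed star_minus)

lemma star_ii: "a \<in> A \<Longrightarrow> star (ii a) = - ii (star a)"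
  using star_smul[of a "\<i>"] op_scale_op_scale[of "-1" "\<i>" "star a"]
    op_scale_of_real[of "-1" "ii (star a)"]
  by simp

lemmas star_simps = star_star star_add star_mul star_scaleR star_minus star_diff star_ii
lemmas mul_simps = mul_add_left mul_add_right mul_diff_left mul_diff_right mul_minus_left
  mul_minus_right mul_scaleR_left mul_scaleR_right mul_smul_left mul_smul_right

lemma norm_star: 
  assumes "a \<in> A"
  shows "norm (star a) = norm a"
proof -
  have le: "norm b \<le> norm (star b)" if "b \<in> A" for b
  proof (cases "b = 0")
    case False
    have "norm b * norm b \<le> norm (star b) * norm b"
      using cstar_identity[OF that] norm_mul_le[OF star_closed[OF that] that]
      by (simp add: power2_eq_square)
    then show ?thesis using False by simp
  qed simp
  show ?thesis
    using le[OF assms] le[OF star_closed[OF assms]] star_star[OF assms] by simp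
qed

lemma star_mul_self_eq_0: "a \<in> A \<Longrightarrow> star a \<odot> a = 0 \<Longrightarrow> a = 0"
  using cstar_identity[of a] by simp

text \<open>First and second order approximations to \<open>exp (its) w\<close>, whose norm is that of \<open>w\<close>.\<close>

lemma norm_rotate_first_order:
  assumes "s \<in> A" "w \<in> A" "star s = s"
  shows "(norm (w + t *\<^sub>R ii (s \<odot> w)))\<^sup>2 \<le> (norm w)\<^sup>2 + norm (star w \<odot> (s \<odot> (s \<odot> w))) * t\<^sup>2"
proof -
  let ?y = "w + t *\<^sub>R ii (s \<odot> w)"
  have "?y \<in> A" using assms by (intro closed)
  then have "(norm ?y)\<^sup>2 = norm (star ?y \<odot> ?y)"
    by (simp add: cstar_identity)
  \<comment> \<open>The terms linear in \<open>t\<close> cancel because \<open>s\<close> is fixed by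
    \<open>star\<close>.\<close>
  also have "star ?y \<odot> ?y = star w \<odot> w + t\<^sup>2 *\<^sub>R (star w \<odot> (s \<odot> (s \<odot> w)))"
    using assms by (simp add: closed star_simps mul_simps mul_assoc ii_simps power2_eq_square algebra_simps)
  also have "norm \<dots> \<le> norm (star w \<odot> w) + norm (t\<^sup>2 *\<^sub>R (star w \<odot> (s \<odot> (s \<odot> w))))"
    by (rule norm_triangle_ineq)
  finally show ?thesis using assms by (simp add: cstar_identity mult.commute)
qed

lemma norm_rotate_second_order:
  assumes "s \<in> A" "w \<in> A" "star s = s"
  shows "(norm (w + t *\<^sub>R ii (s \<odot> w) - (t\<^sup>2 / 2) *\<^sub>R (s \<odot> (s \<odot> w))))\<^sup>2
    \<le> (norm w)\<^sup>2 + norm (star w \<odot> (s \<odot> (s \<odot> (s \<odot> (s \<odot> w))))) / 4 * t ^ 4"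
proof -
  let ?y = "w + t *\<^sub>R ii (s \<odot> w) - (t\<^sup>2 / 2) *\<^sub>R (s \<odot> (s \<odot> w))"
  let ?z = "star w \<odot> (s \<odot> (s \<odot> (s \<odot> (s \<odot> w))))"
  have "?y \<in> A" using assms by (intro closed)
  then have "(norm ?y)\<^sup>2 = norm (star ?y \<odot> ?y)"
    by (simp add: cstar_identity)
  \<comment> \<open>The coefficient \<open>t\<^sup>2 / 2\<close> makes orders one to three cancel:
    \<open>(1 - i t s - t^2 s^2 / 2) (1 + i t s - t^2 s^2 / 2) = 1 + t^4 s^4 / 4\<close>.\<close>
  also have "star ?y \<odot> ?y = star w \<odot> w + (t ^ 4 / 4) *\<^sub>R ?z"
    using assms
    by (simp add: closed star_simps mul_simps mul_assoc ii_simps algebra_simps flip: scaleR_add_left)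
      (simp add: power2_eq_square power4_eq_xxxx flip: scaleR_2)
  also have "norm \<dots> \<le> norm (star w \<odot> w) + norm ((t ^ 4 / 4) *\<^sub>R ?z)"
    by (rule norm_triangle_ineq)
  finally show ?thesis using assms by (simp add: cstar_identity mult.commute)
qed

end

section \<open>Norm conditions for operators\<close>

locale operator_algebra =
  fixes A :: "('h::complex_hilbert_space \<Rightarrow>\<^sub>L 'h) set" and e :: "'h \<Rightarrow>\<^sub>L 'h"
  assumes unital: "unital_operator_algebra A e"
begin

lemma cstar_structure_compose: "cstar_structure A (o\<^sub>L) adjoint_op"
  using unital by (simp add: unital_operator_algebra_def cstar_structure_def)

sublocale Op: cstar_structure A "(o\<^sub>L)" adjoint_op
  by (rule cstar_structure_compose)

lemma bounded: "a \<in> A \<Longrightarrow> a \<in> bounded_operators"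
  and e_closed: "e \<in> A"
  and e_left: "a \<in> A \<Longrightarrow> e o\<^sub>L a = a"
  and e_right: "a \<in> A \<Longrightarrow> a o\<^sub>L e = a"
  using unital by (auto simp: unital_operator_algebra_def)

lemma adjoint_e: "adjoint_op e = e"
  by (metis Op.star_closed Op.star_mul Op.star_star e_closed e_left e_right)

lemma norm_e_le: "norm e \<le> 1"
proof (cases "e = 0")
  case False
  have "norm e * norm e = norm e"
    using Op.cstar_identity[OF e_closed] e_left[OF e_closed] by (simp add: adjoint_e power2_eq_square)
  then show ?thesis using False by simp
qed simp

lemma e_apply: "a \<in> A \<Longrightarrow> blinfun_apply e (blinfun_apply a x) = blinfun_apply a x"
  "a \<in> A \<Longrightarrow> blinfun_apply a (blinfun_apply e x) = blinfun_apply a x"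
  by (metis e_left blinfun_apply_blinfun_compose) (metis e_right blinfun_apply_blinfun_compose)

text \<open>\<open>e\<close> is a self-adjoint idempotent but possibly not the identity operator;
  this lets quadratic forms of elements of \<open>A\<close> be tested only on vectors fixed by
  \<open>e\<close>.\<close>

lemma cinner_reduce:
  assumes "a \<in> A"
  shows "cinner x (blinfun_apply a x) = cinner (blinfun_apply e x) (blinfun_apply a (blinfun_apply e x))"
  using cinner_adjoint_left[OF bounded[OF e_closed], of x "blinfun_apply a x"]
  by (simp add: adjoint_e e_apply assms)

lemma norm_e_apply_le: "norm (blinfun_apply e x) \<le> norm x"
  using norm_blinfun[of e x] norm_e_le mult_right_mono[of "norm e" 1 "norm x"] by simp

lemma norm_apply_le:
  fixes x :: 'h
  assumes "norm T \<le> K"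
  shows "norm (blinfun_apply T x) \<le> K * norm x"
  using norm_blinfun[of T x] mult_right_mono[OF assms, of "norm x"] by simp

lemma norm_square_apply_le:
  fixes x :: 'h
  assumes "(norm T)\<^sup>2 \<le> K"
  shows "(norm (blinfun_apply T x))\<^sup>2 \<le> K * (norm x)\<^sup>2"
proof -
  have "(norm (blinfun_apply T x))\<^sup>2 \<le> (norm T * norm x)\<^sup>2"
    by (intro power_mono norm_blinfun) simp
  also have "\<dots> \<le> K * (norm x)\<^sup>2"
    unfolding power_mult_distrib using assms by (rule mult_right_mono) simp
  finally show ?thesis .
qed

lemma self_adjointI:
  assumes a: "a \<in> A" and "\<And>x. blinfun_apply e x = x \<Longrightarrow> Im (cinner x (blinfun_apply a x)) = 0"
  shows "adjoint_op a = a"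
proof (rule self_adjoint_if_real_form)
  fix x
  show "Im (cinner x (blinfun_apply a x)) = 0"
    unfolding cinner_reduce[OF a, of x] by (rule assms(2)) (rule e_apply(1)[OF e_closed])
qed (rule bounded[OF a])

lemma self_adjoint_form_real:
  assumes "a \<in> A" "adjoint_op a = a"
  shows "Im (cinner x (blinfun_apply a x)) = 0"
proof -
  have "cinner x (blinfun_apply a x) = cnj (cinner x (blinfun_apply a x))"
    using cinner_adjoint_right[OF bounded[OF assms(1)], of x x] assms(2) cinner_commute by metis
  then show ?thesis by (simp add: complex_eq_iff)
qed

text \<open>Self-adjointness and order relations become conditions on norms near \<open>e\<close>; this is what
  transfers between different \<open>C\<^sup>*\<close>-structures with the same norm.\<close>

lemma self_adjointI_norm:
  assumes a: "a \<in> A" and norm: "\<And>t. (norm (e + t *\<^sub>R ii a))\<^sup>2 \<le> 1 + C * t\<^sup>2"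
  shows "adjoint_op a = a"
proof (rule self_adjointI[OF a])
  fix x assume x: "blinfun_apply e x = x"
  \<comment> \<open>The norm bound evaluated at \<open>x\<close>: the cross term
    \<open>- 2 t Im (cinner x (a x))\<close> is the only one linear in \<open>t\<close>.\<close>
  have "0 \<le> (2 * Im (cinner x (blinfun_apply a x))) * t
      + (C * (norm x)\<^sup>2 - (norm (blinfun_apply a x))\<^sup>2) * t\<^sup>2" for t
  proof -
    have "(norm (blinfun_apply (e + t *\<^sub>R ii a) x))\<^sup>2 \<le> (1 + C * t\<^sup>2) * (norm x)\<^sup>2"
      by (intro norm_square_apply_le norm)
    moreover have "blinfun_apply (e + t *\<^sub>R ii a) x = x + t *\<^sub>R (\<i> *\<^sub>C blinfun_apply a x)"
      by (simp add: blinfun_simps x op_scale_apply)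
    ultimately show ?thesis
      by (simp add: norm_add_square cinner_scaleR_right cinner_scaleC_right norm_scaleC
          power_mult_distrib algebra_simps)
  qed
  from linear_coefficient_zero[OF this] show "Im (cinner x (blinfun_apply a x)) = 0"
    by simp
qed

lemma form_ge_norm_squareI:
  assumes a: "a \<in> A" "adjoint_op a = a"
    and norm: "\<And>t. (norm (e + t *\<^sub>R ii a - (t\<^sup>2 / 2) *\<^sub>R c))\<^sup>2 \<le> 1 + C * t ^ 4"
    and x: "blinfun_apply e x = x"
  shows "(norm (blinfun_apply a x))\<^sup>2 \<le> Re (cinner x (blinfun_apply c x))"
proof -
  let ?ax = "blinfun_apply a x" and ?cx = "blinfun_apply c x"
  let ?K = "\<bar>C\<bar> * (norm x)\<^sup>2 + cmod (cinner ?cx ?ax)"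
  \<comment> \<open>The linear term vanishes because \<open>cinner x ?ax\<close> is real, so order
    \<open>t\<^sup>2\<close> decides; higher orders are absorbed into \<open>?K\<close>.\<close>
  have "(norm ?ax)\<^sup>2 - Re (cinner x ?cx) \<le> ?K * t" if t: "0 < t" "t \<le> 1" for t
  proof -
    define y where "y = x - (t\<^sup>2 / 2) *\<^sub>R ?cx"
    have "blinfun_apply (e + t *\<^sub>R ii a - (t\<^sup>2 / 2) *\<^sub>R c) x = y + t *\<^sub>R (\<i> *\<^sub>C ?ax)"
      by (simp add: blinfun_simps x op_scale_apply y_def)
    then have "(norm (y + t *\<^sub>R (\<i> *\<^sub>C ?ax)))\<^sup>2 \<le> (1 + C * t ^ 4) * (norm x)\<^sup>2"
      using norm_square_apply_le[OF norm] by metis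
    moreover have "(norm (y + t *\<^sub>R (\<i> *\<^sub>C ?ax)))\<^sup>2
        = (norm y)\<^sup>2 + t\<^sup>2 * (norm ?ax)\<^sup>2 + 2 * Re (cinner y (t *\<^sub>R (\<i> *\<^sub>C ?ax)))"
      by (simp add: norm_add_square norm_scaleC power_mult_distrib)
    moreover have "2 * Re (cinner y (t *\<^sub>R (\<i> *\<^sub>C ?ax))) = t ^ 3 * Im (cinner ?cx ?ax)"
      using self_adjoint_form_real[OF a, of x]
      by (simp add: y_def cinner.diff_left cinner.scaleR_left cinner.scaleR_right cinner_scaleC_right
          power2_eq_square power3_eq_cube)
    moreover have "(norm x)\<^sup>2 - t\<^sup>2 * Re (cinner x ?cx) \<le> (norm y)\<^sup>2"
      unfolding y_def norm_diff_square by (simp add: cinner.scaleR_right)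
    ultimately have "t\<^sup>2 * ((norm ?ax)\<^sup>2 - Re (cinner x ?cx)) \<le> C * t ^ 4 * (norm x)\<^sup>2 - t ^ 3 * Im (cinner ?cx ?ax)"
      by (simp add: algebra_simps)
    moreover have "C * t ^ 4 * (norm x)\<^sup>2 \<le> \<bar>C\<bar> * t ^ 3 * (norm x)\<^sup>2"
      using t power_decreasing[of 3 4 t] by (intro mult_right_mono mult_mono) auto
    moreover have "- (t ^ 3 * Im (cinner ?cx ?ax)) \<le> t ^ 3 * cmod (cinner ?cx ?ax)"
      using mult_left_mono[of "- Im (cinner ?cx ?ax)" "cmod (cinner ?cx ?ax)" "t ^ 3"]
        abs_Im_le_cmod[of "cinner ?cx ?ax"] t by simp
    ultimately have "t\<^sup>2 * ((norm ?ax)\<^sup>2 - Re (cinner x ?cx))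
        \<le> \<bar>C\<bar> * t ^ 3 * (norm x)\<^sup>2 + t ^ 3 * cmod (cinner ?cx ?ax)"
      by linarith
    also have "\<dots> = t\<^sup>2 * (?K * t)"
      by (simp add: algebra_simps power2_eq_square power3_eq_cube)
    finally show ?thesis by (rule mult_left_le_imp_le) (use t in simp)
  qed
  from nonpos_if_le_small[OF this] show ?thesis by simp
qed

lemma form_nonnegI:
  assumes norm: "\<And>t. 0 < t \<Longrightarrow> t \<le> 1 \<Longrightarrow> norm (e - t\<^sup>2 *\<^sub>R d) \<le> 1 + C * t ^ 3"
    and x: "blinfun_apply e x = x"
  shows "0 \<le> Re (cinner x (blinfun_apply d x))"
proof -
  have "- Re (cinner x (blinfun_apply d x)) \<le> (C * (norm x)\<^sup>2) * t" if t: "0 < t" "t \<le> 1" for t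
  proof -
    have "Re (cinner x (blinfun_apply (e - t\<^sup>2 *\<^sub>R d) x)) \<le> norm x * norm (blinfun_apply (e - t\<^sup>2 *\<^sub>R d) x)"
      using complex_Re_le_cmod Cauchy_Schwarz_cinner order_trans by blast
    also have "\<dots> \<le> norm x * ((1 + C * t ^ 3) * norm x)"
      by (intro mult_left_mono norm_apply_le norm t) simp
    finally have "t\<^sup>2 * - Re (cinner x (blinfun_apply d x)) \<le> t\<^sup>2 * ((C * (norm x)\<^sup>2) * t)"
      by (simp add: blinfun_simps x cinner.diff_right cinner.scaleR_right Re_cinner_self
          power2_eq_square power3_eq_cube algebra_simps)
    then show ?thesis by (rule mult_left_le_imp_le) (use t in simp)
  qed
  from nonpos_if_le_small[OF this] show ?thesis by simp
qed

text \<open>The self-adjoint operator \<open>a - b\<close> has zero form, hence zero norm;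
  \<open>cinner_reduce\<close> handles vectors not fixed by \<open>e\<close>.\<close>

lemma form_determines:
  assumes a: "a \<in> A" "b \<in> A" "adjoint_op a = a" "adjoint_op b = b"
    and form: "\<And>x. blinfun_apply e x = x \<Longrightarrow>
      Re (cinner x (blinfun_apply a x)) = Re (cinner x (blinfun_apply b x))"
  shows "a = b"
proof -
  have d: "a - b \<in> A" "adjoint_op (a - b) = a - b"
    using a by (simp_all add: Op.diff_closed Op.star_diff)
  have "norm (a - b) \<le> 0"
  proof (rule norm_le_if_form_bounded)
    fix x y
    show "cinner (blinfun_apply (a - b) x) y = cinner x (blinfun_apply (a - b) y)"
      using cinner_adjoint_left[OF bounded[OF d(1)]] d(2) by simp
    show "\<bar>Re (cinner x (blinfun_apply (a - b) x))\<bar> \<le> 0 * (norm x)\<^sup>2"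
      unfolding cinner_reduce[OF d(1), of x]
      using form[of "blinfun_apply e x"] e_apply[OF e_closed]
      by (simp add: blinfun_simps cinner.diff_right)
  qed simp
  then show ?thesis by simp
qed

lemma norm_le_if_unit_form_bounded:
  assumes a: "a \<in> A" "adjoint_op a = a" and "0 \<le> K"
    and form: "\<And>x. blinfun_apply e x = x \<Longrightarrow> norm x = 1 \<Longrightarrow> \<bar>Re (cinner x (blinfun_apply a x))\<bar> \<le> K"
  shows "norm a \<le> K"
proof (rule norm_le_if_form_bounded)
  fix x y
  show "cinner (blinfun_apply a x) y = cinner x (blinfun_apply a y)"
    using cinner_adjoint_left[OF bounded[OF a(1)]] a(2) by simp
  define z where "z = blinfun_apply e x"
  have z: "blinfun_apply e z = z" by (simp add: z_def e_apply e_closed)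
  have "\<bar>Re (cinner z (blinfun_apply a z))\<bar> \<le> K * (norm z)\<^sup>2"
  proof (cases "z = 0")
    case False
    have "\<bar>Re (cinner ((1 / norm z) *\<^sub>R z) (blinfun_apply a ((1 / norm z) *\<^sub>R z)))\<bar> \<le> K"
      using False by (intro form) (simp_all add: blinfun_simps z)
    then show ?thesis
      using False by (simp add: blinfun_simps cinner.scaleR_left cinner.scaleR_right abs_mult
          power2_eq_square field_simps)
  qed (simp add: cinner.zero_left)
  also have "\<dots> \<le> K * (norm x)\<^sup>2"
    unfolding z_def by (intro mult_left_mono power_mono norm_e_apply_le \<open>0 \<le> K\<close>) simp
  finally show "\<bar>Re (cinner x (blinfun_apply a x))\<bar> \<le> K * (norm x)\<^sup>2"
    by (simp only: z_def cinner_reduce[OF a(1), of x])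
qed (rule \<open>0 \<le> K\<close>)

end

section \<open>The second structure\<close>

locale second_structure = operator_algebra A e + cstar_structure A mul star
  for A :: "('h::complex_hilbert_space \<Rightarrow>\<^sub>L 'h) set" and e :: "'h \<Rightarrow>\<^sub>L 'h"
    and mul :: "('h \<Rightarrow>\<^sub>L 'h) \<Rightarrow> ('h \<Rightarrow>\<^sub>L 'h) \<Rightarrow> ('h \<Rightarrow>\<^sub>L 'h)" (infixl "\<odot>" 70)
    and star :: "('h \<Rightarrow>\<^sub>L 'h) \<Rightarrow> ('h \<Rightarrow>\<^sub>L 'h)"
begin

lemma norm_e_square_le: "(norm e)\<^sup>2 \<le> 1"
  using norm_e_le by (simp add: power_le_one)

text \<open>\<open>e + t *\<^sub>R ii (s \<odot> e)\<close> approximates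
  \<open>exp (i t s) \<odot> e\<close> to first order. The second structure bounds its norm, and the
  operator structure reads self-adjointness off that bound.\<close>

lemma self_adjoint_mul_e:
  assumes s: "s \<in> A" "star s = s"
  shows "adjoint_op (s \<odot> e) = s \<odot> e"
proof (rule self_adjointI_norm)
  show "(norm (e + t *\<^sub>R ii (s \<odot> e)))\<^sup>2 \<le> 1 + norm (star e \<odot> (s \<odot> (s \<odot> e))) * t\<^sup>2" for t
    using norm_rotate_first_order[OF s(1) e_closed s(2), of t] norm_e_square_le by linarith
qed (simp add: closed s e_closed)

text \<open>The rotation estimate only covers multiplication from the left; it is applied to
  \<open>star e\<close> and carried over by the isometry \<open>star\<close>.\<close>

lemma self_adjoint_e_mul:
  assumes s: "s \<in> A" "star s = s"
  shows "adjoint_op (e \<odot> s) = e \<odot> s"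
proof (rule self_adjointI_norm)
  fix t
  let ?y = "e + t *\<^sub>R ii (e \<odot> s)"
  have "(norm ?y)\<^sup>2 = (norm (star ?y))\<^sup>2"
    using s e_closed by (simp add: closed norm_star)
  also have "star ?y = star e + (- t) *\<^sub>R ii (s \<odot> star e)"
    using s e_closed by (simp add: closed star_simps)
  also have "(norm \<dots>)\<^sup>2 \<le> (norm (star e))\<^sup>2 + norm (star (star e) \<odot> (s \<odot> (s \<odot> star e))) * (- t)\<^sup>2"
    using s e_closed by (intro norm_rotate_first_order star_closed)
  finally show "(norm ?y)\<^sup>2 \<le> 1 + norm (star (star e) \<odot> (s \<odot> (s \<odot> star e))) * t\<^sup>2"
    using norm_e_square_le e_closed by (simp add: norm_star)
qed (simp add: closed s e_closed)

text \<open>A form of Kadison's inequality that does not yet need a common unit, obtained from the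
  second-order rotation.\<close>

lemma form_square_mul_e:
  assumes s: "s \<in> A" "star s = s" and x: "blinfun_apply e x = x"
  shows "(norm (blinfun_apply (s \<odot> e) x))\<^sup>2 \<le> Re (cinner x (blinfun_apply (s \<odot> (s \<odot> e)) x))"
proof (rule form_ge_norm_squareI)
  show "(norm (e + t *\<^sub>R ii (s \<odot> e) - (t\<^sup>2 / 2) *\<^sub>R (s \<odot> (s \<odot> e))))\<^sup>2
      \<le> 1 + norm (star e \<odot> (s \<odot> (s \<odot> (s \<odot> (s \<odot> e))))) / 4 * t ^ 4" for t
    using norm_rotate_second_order[OF s(1) e_closed s(2), of t] norm_e_square_le by linarith
qed (use s x e_closed in \<open>simp_all add: closed self_adjoint_mul_e\<close>)

end

section \<open>Norms of cubes in a C*-algebra\<close>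

context cstar_structure
begin

lemma norm_self_adjoint_square: "q \<in> A \<Longrightarrow> star q = q \<Longrightarrow> norm (q \<odot> q) = (norm q)\<^sup>2"
  using cstar_identity[of q] by simp

text \<open>For \<open>q = star a \<odot> a\<close> the fourth power has norm
  \<open>norm q ^ 4\<close>, so the cube of \<open>q\<close> has norm at least
  \<open>norm q ^ 3\<close>; that cube equals
  \<open>star (a \<odot> q) \<odot> (a \<odot> q)\<close>.\<close>

lemma norm_cube_le:
  assumes a: "a \<in> A"
  shows "(norm a) ^ 3 \<le> norm (a \<odot> (star a \<odot> a))"
proof (cases "a = 0")
  case False
  define q where "q = star a \<odot> a"
  have q: "q \<in> A" "star q = q" and nq: "norm q = (norm a)\<^sup>2"
    using a by (simp_all add: q_def closed star_simps cstar_identity)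
  have "(norm a)\<^sup>2 * (norm a) ^ 6 = norm ((q \<odot> q) \<odot> (q \<odot> q))"
    using q by (simp add: norm_self_adjoint_square closed star_simps nq flip: power_mult power_add)
  also have "\<dots> = norm ((q \<odot> (q \<odot> q)) \<odot> q)"
    using q by (simp add: mul_assoc closed)
  also have "\<dots> \<le> (norm a)\<^sup>2 * norm (q \<odot> (q \<odot> q))"
    using norm_mul_le[of "q \<odot> (q \<odot> q)" q] q by (simp add: closed nq mult.commute)
  finally have "(norm a) ^ 6 \<le> norm (q \<odot> (q \<odot> q))"
    by (rule mult_left_le_imp_le) (simp add: False)
  also have "\<dots> = norm (star (a \<odot> q) \<odot> (a \<odot> q))"
  proof -
    have "star (a \<odot> q) \<odot> (a \<odot> q) = q \<odot> ((star a \<odot> a) \<odot> q)"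
      using a q by (simp add: star_simps closed mul_assoc)
    then show ?thesis by (simp only: q_def[symmetric])
  qed
  also have "\<dots> = (norm (a \<odot> q))\<^sup>2"
    using a q by (simp add: cstar_identity closed)
  finally have "((norm a) ^ 3)\<^sup>2 \<le> (norm (a \<odot> q))\<^sup>2"
    by (simp flip: power_mult)
  then show ?thesis
    unfolding q_def by (rule power2_le_imp_le) simp
qed simp

end

section \<open>The unit of the second product\<close>

context second_structure
begin

text \<open>Adding and subtracting the two self-adjointness conditions isolates
  \<open>adjoint_op X\<close>. This carries results from self-adjoint elements to arbitrary
  ones.\<close>

lemma adjoint_eqI:
  assumes X: "X \<in> A" "Y \<in> A"
    and sa: "adjoint_op (X + Y) = X + Y" "adjoint_op (ii (X - Y)) = ii (X - Y)"
  shows "adjoint_op X = Y"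
proof -
  have 1: "adjoint_op X + adjoint_op Y = X + Y"
    using sa(1) X by (simp add: Op.star_add)
  have "ii (adjoint_op Y - adjoint_op X) = ii (X - Y)"
    using sa(2) Op.star_ii[OF Op.diff_closed[OF X]] X
    by (simp only: Op.star_diff op_scale_diff_right minus_diff_eq)
  then have 2: "adjoint_op Y - adjoint_op X = X - Y"
    by (simp only: ii_eq_iff)
  have "(adjoint_op X + adjoint_op Y) - (adjoint_op Y - adjoint_op X) = Y + Y"
    unfolding 1 2 by simp
  then have "2 *\<^sub>R adjoint_op X = 2 *\<^sub>R Y"
    by (simp add: scaleR_2)
  then show ?thesis by simp
qed

text \<open>The sum of the two elements is
  \<open>(b \<odot> star e + e \<odot> star b) \<odot> e\<close>, whose left factor is fixed by
  \<open>star\<close>; \<open>ii\<close> times the difference factors alike. So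
  \<open>self_adjoint_mul_e\<close> applies to both.\<close>

lemma adjoint_mul_support:
  assumes b: "b \<in> A"
  shows "adjoint_op (b \<odot> (star e \<odot> e)) = e \<odot> (star b \<odot> e)"
proof (rule adjoint_eqI)
  note [simp] = closed star_simps mul_simps mul_assoc ii_simps b e_closed
  show "adjoint_op (b \<odot> (star e \<odot> e) + e \<odot> (star b \<odot> e)) = b \<odot> (star e \<odot> e) + e \<odot> (star b \<odot> e)"
    using self_adjoint_mul_e[of "b \<odot> star e + e \<odot> star b"] by (simp add: add.commute)
  show "adjoint_op (ii (b \<odot> (star e \<odot> e) - e \<odot> (star b \<odot> e)))
      = ii (b \<odot> (star e \<odot> e) - e \<odot> (star b \<odot> e))"
    using self_adjoint_mul_e[of "ii (b \<odot> star e - e \<odot> star b)"] by simp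
qed (simp_all add: closed b e_closed)

text \<open>Mirror image of the previous argument: \<open>e\<close> is factored out on the left and
  \<open>self_adjoint_e_mul\<close> is used.\<close>

lemma adjoint_support_mul:
  assumes b: "b \<in> A"
  shows "adjoint_op (e \<odot> (star e \<odot> b)) = e \<odot> (star b \<odot> e)"
proof (rule adjoint_eqI)
  note [simp] = closed star_simps mul_simps mul_assoc ii_simps b e_closed
  show "adjoint_op (e \<odot> (star e \<odot> b) + e \<odot> (star b \<odot> e)) = e \<odot> (star e \<odot> b) + e \<odot> (star b \<odot> e)"
    using self_adjoint_e_mul[of "star e \<odot> b + star b \<odot> e"] by (simp add: add.commute)
  show "adjoint_op (ii (e \<odot> (star e \<odot> b) - e \<odot> (star b \<odot> e)))
      = ii (e \<odot> (star e \<odot> b) - e \<odot> (star b \<odot> e))"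
    using self_adjoint_e_mul[of "ii (star e \<odot> b - star b \<odot> e)"] by simp
qed (simp_all add: closed b e_closed)

text \<open>The candidate for the unit of \<open>\<odot>\<close>, whose existence is not assumed;
  \<open>one_left\<close> and \<open>one_right\<close> confirm it.\<close>

definition one :: "'h \<Rightarrow>\<^sub>L 'h" where "one = e \<odot> star e"

lemma one_closed: "one \<in> A" and star_one: "star one = one"
  by (simp_all add: one_def closed star_simps e_closed)

text \<open>Both sides have the adjoint \<open>e \<odot> (star b \<odot> e)\<close>.\<close>

lemma mul_support: "b \<in> A \<Longrightarrow> b \<odot> (star e \<odot> e) = one \<odot> b"
  using adjoint_mul_support[of b] adjoint_support_mul[of b]
    Op.star_star[of "b \<odot> (star e \<odot> e)"] Op.star_star[of "e \<odot> (star e \<odot> b)"]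
  by (simp add: closed e_closed mul_assoc one_def)

text \<open>\<open>mul_support\<close> for \<open>Q\<close> and for \<open>one\<close> makes all
  four products of \<open>Q\<close> and \<open>one\<close> coincide, so their self-adjoint
  difference squares to zero.\<close>

lemma star_e_mul_e: "star e \<odot> e = one"
proof -
  define Q where "Q = star e \<odot> e"
  have Q: "Q \<in> A" "star Q = Q"
    by (simp_all add: Q_def closed star_simps e_closed)
  have QQ: "Q \<odot> Q = one \<odot> Q" and oQ: "one \<odot> Q = one \<odot> one"
    using mul_support[of Q] mul_support[of one] Q one_closed by (simp_all add: Q_def)
  have "Q \<odot> one = one \<odot> one"
    using arg_cong[OF oQ, of star] Q one_closed star_one by (simp add: star_simps)
  then have "star (one - Q) \<odot> (one - Q) = 0"
    using QQ oQ Q one_closed star_one by (simp add: star_simps mul_simps closed)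
  then have "one - Q = 0"
    by (rule star_mul_self_eq_0[rotated]) (intro closed Q one_closed)
  then show ?thesis by (simp add: Q_def)
qed

lemma one_central: "b \<in> A \<Longrightarrow> b \<odot> one = one \<odot> b"
  using mul_support star_e_mul_e by simp

lemma norm_one_le: "norm one \<le> 1"
  unfolding one_def using norm_mul_le[of e "star e"] norm_e_le
  by (simp add: norm_star closed e_closed) (meson mult_le_one norm_ge_zero order_trans)

lemma norm_one_mul_le: "b \<in> A \<Longrightarrow> norm b \<le> 1 \<Longrightarrow> norm (one \<odot> b) \<le> 1"
  using norm_mul_le[of one b] norm_one_le one_closed
  by (meson mult_le_one norm_ge_zero order_trans)

text \<open>\<open>4 *\<^sub>R one\<close> is the sum of the squares of \<open>h\<close> and
  \<open>k\<close>, which up to sign are twice the real and imaginary parts of \<open>e\<close>.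
  Each square contributes a nonnegative form.\<close>

lemma form_one_mul_e_nonneg:
  assumes x: "blinfun_apply e x = x"
  shows "0 \<le> Re (cinner x (blinfun_apply (one \<odot> e) x))"
proof -
  define h k where "h = e + star e" and "k = ii (e - star e)"
  note [simp] = closed star_simps mul_simps ii_simps e_closed
  have h: "h \<in> A" "star h = h" and k: "k \<in> A" "star k = k"
    by (simp_all add: h_def k_def)
  have "h \<odot> h + k \<odot> k = 4 *\<^sub>R one"
    by (simp add: h_def k_def star_e_mul_e one_def[symmetric] flip: scaleR_add_left)
      (simp flip: scaleR_2)
  then have "(h \<odot> h + k \<odot> k) \<odot> e = 4 *\<^sub>R (one \<odot> e)"
    using one_closed by simp
  then have "h \<odot> (h \<odot> e) + k \<odot> (k \<odot> e) = 4 *\<^sub>R (one \<odot> e)"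
    using h k by (simp add: mul_assoc)
  then have "Re (cinner x (blinfun_apply (h \<odot> (h \<odot> e)) x)) + Re (cinner x (blinfun_apply (k \<odot> (k \<odot> e)) x))
      = 4 * Re (cinner x (blinfun_apply (one \<odot> e) x))"
    by (metis blinfun.add_left blinfun.scaleR_left cinner.add_right cinner.scaleR_right
        plus_complex.sel(1) scaleR_complex.sel(1))
  moreover have "0 \<le> Re (cinner x (blinfun_apply (h \<odot> (h \<odot> e)) x))"
      "0 \<le> Re (cinner x (blinfun_apply (k \<odot> (k \<odot> e)) x))"
    using form_square_mul_e[OF h x] form_square_mul_e[OF k x] zero_le_power2 order_trans by blast+
  ultimately show ?thesis by linarith
qed

text \<open>With \<open>z = one \<odot> e\<close> and \<open>a = e + t (e - z)\<close>, the norm of \<open>a\<close> is at least \<open>1 + t \<alpha>\<close>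
  where \<open>\<alpha> = \<langle>x, (e - z) x\<rangle>\<close>, whereas the cube of \<open>a\<close> has norm at most \<open>1 + O(t\<^sup>2)\<close>.\<close>

lemma one_mul_e: "one \<odot> e = e"
proof -
  note [simp] = closed star_simps mul_simps e_closed one_closed star_one
  define z z2 z3 z4 where "z = one \<odot> e" and "z2 = one \<odot> z" and "z3 = one \<odot> z2" and "z4 = one \<odot> z3"
  have zA[simp]: "z \<in> A" "z2 \<in> A" "z3 \<in> A" "z4 \<in> A"
    by (simp_all add: z_def z2_def z3_def z4_def)
  have nz: "norm z \<le> 1" "norm z2 \<le> 1" "norm z3 \<le> 1" "norm z4 \<le> 1"
    unfolding z_def z2_def z3_def z4_def by (intro norm_one_mul_le norm_e_le closed e_closed one_closed)+
  have sa: "adjoint_op z = z" "adjoint_op z2 = z2"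
    using self_adjoint_mul_e[of one] self_adjoint_mul_e[of "one \<odot> one"]
    by (simp_all add: z_def z2_def mul_assoc)
  define m n where "m x = Re (cinner x (blinfun_apply z x))" and "n x = Re (cinner x (blinfun_apply z2 x))" for x
  have form_le: "\<bar>Re (cinner x (blinfun_apply b x))\<bar> \<le> norm b" if "norm x = 1" for b and x :: 'h
    using Cauchy_Schwarz_cinner[of x "blinfun_apply b x"] norm_blinfun[of b x]
      abs_Re_le_cmod[of "cinner x (blinfun_apply b x)"] that by simp
  have mn: "0 \<le> m x" "m x \<le> 1" "(m x)\<^sup>2 \<le> n x" "n x \<le> 1" if x: "blinfun_apply e x = x" "norm x = 1" for x
  proof -
    show "0 \<le> m x" using form_one_mul_e_nonneg[OF x(1)] by (simp add: m_def z_def)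
    show "m x \<le> 1" "n x \<le> 1"
      using form_le[OF x(2), of z] form_le[OF x(2), of z2] nz by (simp_all add: m_def n_def)
    have "m x \<le> norm (blinfun_apply z x)"
      using Cauchy_Schwarz_cinner[of x "blinfun_apply z x"] complex_Re_le_cmod[of "cinner x (blinfun_apply z x)"] x(2)
      by (simp add: m_def)
    then have "(m x)\<^sup>2 \<le> (norm (blinfun_apply z x))\<^sup>2"
      using \<open>0 \<le> m x\<close> by (rule power_mono)
    also have "\<dots> \<le> n x"
      using form_square_mul_e[of one x] x(1) by (simp add: n_def z2_def z_def)
    finally show "(m x)\<^sup>2 \<le> n x" .
  qed
  \<comment> \<open>This operator is the cube of \<open>a\<close> up to first order. As
    \<open>(m x)\<^sup>2 \<le> n x\<close>, its form is at most \<open>m + 3 t (m - m^2)\<close>,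
    and \<open>(1 - m) (1 - 3 t m) \<ge> 0\<close> bounds that by 1.\<close>
  have norm_le: "norm (z + (3 * t) *\<^sub>R (z - z2)) \<le> 1" if t: "0 < t" "t \<le> 1/6" for t :: real
  proof (rule norm_le_if_unit_form_bounded)
    show "adjoint_op (z + (3 * t) *\<^sub>R (z - z2)) = z + (3 * t) *\<^sub>R (z - z2)"
      by (simp add: Op.star_simps sa Op.closed)
    fix x :: 'h assume x: "blinfun_apply e x = x" "norm x = 1"
    have "0 \<le> (1 - m x) * (1 - 3 * t * m x)"
      using mn[OF x] t mult_mono[of "3 * t" 1 "m x" 1] by (intro mult_nonneg_nonneg) auto
    then have "m x + 3 * t * (m x - (m x)\<^sup>2) \<le> 1"
      by (simp add: algebra_simps power2_eq_square)
    moreover have "3 * t * (m x - n x) \<le> 3 * t * (m x - (m x)\<^sup>2)"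
      using mn[OF x] t by (intro mult_left_mono) auto
    moreover have "3 * t * (- 1) \<le> 3 * t * (m x - n x)"
      using mn[OF x] t by (intro mult_left_mono) auto
    moreover have "Re (cinner x (blinfun_apply (z + (3 * t) *\<^sub>R (z - z2)) x)) = m x + 3 * t * (m x - n x)"
      by (simp add: m_def n_def blinfun_simps cinner.add_right cinner.scaleR_right cinner.diff_right)
    ultimately show "\<bar>Re (cinner x (blinfun_apply (z + (3 * t) *\<^sub>R (z - z2)) x))\<bar> \<le> 1"
      using mn(1)[OF x] t by linarith
  qed simp_all
  \<comment> \<open>Since \<open>one\<close> is central and equals \<open>star e \<odot> e\<close>,
    the products in the cube of \<open>a\<close> reduce to powers of \<open>one\<close>, possibly
    times \<open>e\<close>.\<close>
  have prods: "star e \<odot> z = one \<odot> one" "star z \<odot> e = one \<odot> one" "star z \<odot> z = one \<odot> (one \<odot> one)"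
    "e \<odot> one = z" "e \<odot> (one \<odot> one) = z2" "e \<odot> (one \<odot> (one \<odot> one)) = z3"
    "z \<odot> one = z2" "z \<odot> (one \<odot> one) = z3" "z \<odot> (one \<odot> (one \<odot> one)) = z4"
  proof -
    have comm: "c \<odot> (one \<odot> b) = one \<odot> (c \<odot> b)" if "c \<in> A" "b \<in> A" for b c
      using that by (simp add: one_central flip: mul_assoc)
    note rules = z2_def z3_def z4_def z_def mul_assoc comm[of e] comm[of "star e"] star_e_mul_e
      one_central[OF e_closed] one_central[OF star_closed[OF e_closed]]
    show "star e \<odot> z = one \<odot> one" "star z \<odot> e = one \<odot> one" "star z \<odot> z = one \<odot> (one \<odot> one)"
      by (simp_all add: rules)
    show "e \<odot> one = z" "e \<odot> (one \<odot> one) = z2" "e \<odot> (one \<odot> (one \<odot> one)) = z3"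
      "z \<odot> one = z2" "z \<odot> (one \<odot> one) = z3" "z \<odot> (one \<odot> (one \<odot> one)) = z4"
      by (simp_all add: rules)
  qed
  have m1: "m x = 1" if x: "blinfun_apply e x = x" "norm x = 1" for x
  proof -
    have "3 * (1 - m x) \<le> 20 * t" if t: "0 < t" "t \<le> 1/6" for t
    proof -
      define r where "r = 1 + t"
      define a where "a = r *\<^sub>R e - t *\<^sub>R z"
      have a: "a \<in> A" by (simp add: a_def)
      have "Re (cinner x (blinfun_apply a x)) = 1 + t * (1 - m x)"
        using x by (simp add: a_def r_def m_def blinfun_simps cinner.add_right cinner.diff_right cinner.scaleR_right
            Re_cinner_self algebra_simps)
      then have "1 + t * (1 - m x) \<le> norm a"
        using form_le[OF x(2), of a] by linarith
      then have "(1 + t * (1 - m x)) ^ 3 \<le> (norm a) ^ 3"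
        using mn[OF x] t by (intro power_mono) auto
      also have "\<dots> \<le> norm (a \<odot> (star a \<odot> a))"
        by (rule norm_cube_le[OF a])
      also have "star a \<odot> a = r\<^sup>2 *\<^sub>R one - (2 * r * t) *\<^sub>R (one \<odot> one) + t\<^sup>2 *\<^sub>R (one \<odot> (one \<odot> one))"
        by (simp add: a_def prods star_e_mul_e algebra_simps power2_eq_square flip: scaleR_add_left)
      \<comment> \<open>The cube is \<open>r^3 z - 3 r^2 t z2 + 3 r t^2 z3 - t^3 z4\<close>;
        substituting \<open>r = 1 + t\<close> splits off a remainder of order
        \<open>t^2\<close>.\<close>
      also have "a \<odot> \<dots> = (z + (3 * t) *\<^sub>R (z - z2)) + t\<^sup>2 *\<^sub>R ((3 + t) *\<^sub>R z - (6 + 3 * t) *\<^sub>R z2 + (3 * r) *\<^sub>R z3 - t *\<^sub>R z4)"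
      proof -
        have "a \<odot> (r\<^sup>2 *\<^sub>R one - (2 * r * t) *\<^sub>R (one \<odot> one) + t\<^sup>2 *\<^sub>R (one \<odot> (one \<odot> one)))
            = r *\<^sub>R (r\<^sup>2 *\<^sub>R z - (2 * r * t) *\<^sub>R z2 + t\<^sup>2 *\<^sub>R z3)
              - t *\<^sub>R (r\<^sup>2 *\<^sub>R z2 - (2 * r * t) *\<^sub>R z3 + t\<^sup>2 *\<^sub>R z4)"
          by (simp add: a_def prods algebra_simps)
        also have "\<dots> = (r * r\<^sup>2) *\<^sub>R z + (- (r * (2 * r * t)) - t * r\<^sup>2) *\<^sub>R z2
            + (r * t\<^sup>2 + t * (2 * r * t)) *\<^sub>R z3 - (t * t\<^sup>2) *\<^sub>R z4"
          by (simp only: scaleR_right_distrib scaleR_right_diff_distrib scaleR_left_distrib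
              scaleR_left_diff_distrib scaleR_scaleR scaleR_minus_left) simp
        also have "\<dots> = (1 + 3 * t + t\<^sup>2 * (3 + t)) *\<^sub>R z + (- (3 * t) - t\<^sup>2 * (6 + 3 * t)) *\<^sub>R z2
            + (t\<^sup>2 * (3 * r)) *\<^sub>R z3 - (t\<^sup>2 * t) *\<^sub>R z4"
        proof -
          have "r * r\<^sup>2 = 1 + 3 * t + t\<^sup>2 * (3 + t)" "- (r * (2 * r * t)) - t * r\<^sup>2 = - (3 * t) - t\<^sup>2 * (6 + 3 * t)"
            "r * t\<^sup>2 + t * (2 * r * t) = t\<^sup>2 * (3 * r)" "t * t\<^sup>2 = t\<^sup>2 * t"
            by (simp_all add: r_def algebra_simps power2_eq_square)
          then show ?thesis by (simp only:)
        qed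
        also have "\<dots> = (z + (3 * t) *\<^sub>R (z - z2))
            + t\<^sup>2 *\<^sub>R ((3 + t) *\<^sub>R z - (6 + 3 * t) *\<^sub>R z2 + (3 * r) *\<^sub>R z3 - t *\<^sub>R z4)"
          by (simp only: scaleR_right_distrib scaleR_right_diff_distrib scaleR_left_distrib
              scaleR_left_diff_distrib scaleR_scaleR scaleR_minus_left distrib_left scaleR_one) simp
        finally show ?thesis .
      qed
      also have "norm \<dots> \<le> norm (z + (3 * t) *\<^sub>R (z - z2)) + t\<^sup>2 * norm ((3 + t) *\<^sub>R z - (6 + 3 * t) *\<^sub>R z2 + (3 * r) *\<^sub>R z3 - t *\<^sub>R z4)"
        by (rule order_trans[OF norm_triangle_ineq]) simp
      also have "\<dots> \<le> 1 + t\<^sup>2 * 20"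
      proof (intro add_mono norm_le t mult_left_mono)
        have "norm ((3 + t) *\<^sub>R z - (6 + 3 * t) *\<^sub>R z2 + (3 * r) *\<^sub>R z3 - t *\<^sub>R z4)
            \<le> norm ((3 + t) *\<^sub>R z) + norm ((6 + 3 * t) *\<^sub>R z2) + norm ((3 * r) *\<^sub>R z3) + norm (t *\<^sub>R z4)"
          by (intro order_trans[OF norm_triangle_ineq4] order_trans[OF norm_triangle_ineq] add_mono order_refl)
        also have "\<dots> \<le> (3 + t) * 1 + (6 + 3 * t) * 1 + (3 * r) * 1 + t * 1"
          using t nz unfolding norm_scaleR by (intro add_mono mult_mono) (auto simp: r_def)
        also have "\<dots> \<le> 20" using t by (simp add: r_def)
        finally show "norm ((3 + t) *\<^sub>R z - (6 + 3 * t) *\<^sub>R z2 + (3 * r) *\<^sub>R z3 - t *\<^sub>R z4) \<le> 20" .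
      qed simp
      finally have "(1 + t * (1 - m x)) ^ 3 \<le> 1 + t\<^sup>2 * 20" .
      moreover have "1 + 3 * (t * (1 - m x)) \<le> (1 + t * (1 - m x)) ^ 3"
      proof -
        have "0 \<le> t * (1 - m x)"
          using mn(2)[OF x] t by (intro mult_nonneg_nonneg) auto
        then have "- 1 \<le> t * (1 - m x)" by linarith
        from Bernoulli_inequality[OF this, of 3] show ?thesis by simp
      qed
      ultimately have "t * (3 * (1 - m x)) \<le> t * (20 * t)"
        by (simp add: power2_eq_square algebra_simps)
      then show ?thesis by (rule mult_left_le_imp_le) (rule t)
    qed
    then have "3 * (1 - m x) \<le> 0"
      by (rule nonpos_if_le_small[where \<delta> = "1/6"]) simp_all
    with mn(2)[OF x] show ?thesis by simp
  qed
  have "norm (z - e) \<le> 0"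
  proof (rule norm_le_if_unit_form_bounded)
    fix x :: 'h assume x: "blinfun_apply e x = x" "norm x = 1"
    then show "\<bar>Re (cinner x (blinfun_apply (z - e) x))\<bar> \<le> 0"
      using m1[OF x] by (simp add: m_def blinfun_simps cinner.diff_right Re_cinner_self)
  qed (simp_all add: Op.star_diff sa adjoint_e)
  then show ?thesis by (simp add: z_def)
qed

text \<open>The defect \<open>y\<close> satisfies \<open>star e \<odot> y = 0\<close>, so cross
  terms vanish and the norms of \<open>e + t *\<^sub>R y\<close> and
  \<open>e + t *\<^sub>R ii y\<close> exceed 1 at most to second order. Hence \<open>y\<close> and
  \<open>- ii y\<close> are both self-adjoint operators, which forces \<open>y = 0\<close>.\<close>

lemma one_left: 
  assumes b: "b \<in> A"
  shows "one \<odot> b = b"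
proof -
  note [simp] = closed star_simps mul_simps e_closed one_closed star_one b
  define y where "y = b - one \<odot> b"
  have y: "y \<in> A" by (simp add: y_def)
  have "star e \<odot> one = star e"
    using arg_cong[OF one_mul_e, of star] by simp
  then have "star e \<odot> y = 0"
    by (simp add: y_def mul_assoc[symmetric])
  then have ey: "star e \<odot> y = 0" "star y \<odot> e = 0"
    using y star_mul[of "star e" y] mul_zero_left[OF y] star_scaleR[of 0 0] zero_closed by simp_all
  have norm: "(norm (e + t *\<^sub>R y'))\<^sup>2 \<le> 1 + norm (star y' \<odot> y') * t\<^sup>2" if "y' = y \<or> y' = ii y" for t y'
  proof -
    have y': "y' \<in> A" "star e \<odot> y' = 0" "star y' \<odot> e = 0"
      using that y ey by (auto simp: ii_simps)
    have "(norm (e + t *\<^sub>R y'))\<^sup>2 = norm (star (e + t *\<^sub>R y') \<odot> (e + t *\<^sub>R y'))"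
      using y' by (intro cstar_identity[symmetric] closed e_closed)
    also have "star (e + t *\<^sub>R y') \<odot> (e + t *\<^sub>R y') = one + t\<^sup>2 *\<^sub>R (star y' \<odot> y')"
      using y' by (simp add: star_e_mul_e power2_eq_square)
    also have "norm \<dots> \<le> 1 + norm (star y' \<odot> y') * t\<^sup>2"
      using norm_triangle_ineq[of one "t\<^sup>2 *\<^sub>R (star y' \<odot> y')"] norm_one_le by (simp add: mult.commute)
    finally show ?thesis .
  qed
  have "adjoint_op y = y"
    by (rule self_adjointI_norm[OF y]) (rule norm, simp)
  moreover have "adjoint_op (- ii y) = - ii y"
    by (rule self_adjointI_norm[where C = "norm (star y \<odot> y)"])
      (use y norm[of y] in \<open>simp_all add: ii_simps\<close>)
  ultimately have "ii y = - ii y"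
    using y by (simp add: Op.star_simps)
  then have "ii y + ii y = 0"
    by (metis add.left_inverse)
  then have "ii y = 0"
    by (simp flip: scaleR_2)
  then have "ii (ii y) = ii 0" by simp
  then have "y = 0"
    by (simp add: ii_simps)
  then show ?thesis by (simp add: y_def)
qed

lemma one_right: "b \<in> A \<Longrightarrow> b \<odot> one = b"
  by (simp add: one_central one_left)

end

text \<open>Semiprimeness of C*-algebras: \<open>y = star T\<close> turns the hypothesis into the
  vanishing of the cube in \<open>norm_cube_le\<close>.\<close>

lemma (in cstar_structure) zero_if_mul_self_zero:
  assumes T: "T \<in> A" and zero: "\<And>y. y \<in> A \<Longrightarrow> T \<odot> (y \<odot> T) = 0"
  shows "T = 0"
  using norm_cube_le[OF T] zero[OF star_closed[OF T]] by simp

text \<open>This holds in every semiprime ring without 2-torsion.\<close>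

lemma (in cstar_structure) mul_mul_zero_if_symmetric_zero:
  assumes ab: "a \<in> A" "b \<in> A" and zero: "\<And>x. x \<in> A \<Longrightarrow> a \<odot> x \<odot> b + b \<odot> x \<odot> a = 0"
    and x: "x \<in> A"
  shows "a \<odot> x \<odot> b = 0"
proof (rule zero_if_mul_self_zero)
  note [simp] = closed ab x
  have swap: "b \<odot> (z \<odot> (a \<odot> w)) = - (a \<odot> (z \<odot> (b \<odot> w)))" if "z \<in> A" "w \<in> A" for z w
  proof -
    have "b \<odot> z \<odot> a \<odot> w = - (a \<odot> z \<odot> b) \<odot> w"
      using zero[OF that(1)] by (simp add: add_eq_0_iff)
    then show ?thesis using that by (simp add: mul_assoc mul_minus_left)
  qed
  have swap': "a \<odot> (z \<odot> (b \<odot> w)) = - (b \<odot> (z \<odot> (a \<odot> w)))" if "z \<in> A" "w \<in> A" for z w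
    by (simp add: swap[OF that])
  fix y assume y: "y \<in> A"
  note [simp] = y
  \<comment> \<open>Three exchanges of \<open>a\<close> and \<open>b\<close>, each costing a sign,
    return \<open>?T\<close> to itself, whence \<open>?T = - ?T\<close>.\<close>
  let ?T = "a \<odot> (x \<odot> (b \<odot> (y \<odot> (a \<odot> (x \<odot> b)))))"
  have "?T = - (a \<odot> ((x \<odot> (a \<odot> y)) \<odot> (b \<odot> (x \<odot> b))))"
    by (simp add: swap mul_minus_right mul_assoc)
  also have "\<dots> = b \<odot> ((x \<odot> (a \<odot> y)) \<odot> (a \<odot> (x \<odot> b)))"
    by (subst swap') simp_all
  also have "\<dots> = b \<odot> (x \<odot> (a \<odot> (y \<odot> (a \<odot> (x \<odot> b)))))"
    by (simp add: mul_assoc)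
  also have "\<dots> = - ?T"
    by (rule swap) simp_all
  finally have "?T + ?T = 0"
    by (metis add.left_inverse)
  then have "?T = 0"
    by (simp flip: scaleR_2)
  then show "a \<odot> x \<odot> b \<odot> (y \<odot> (a \<odot> x \<odot> b)) = 0"
    by (simp add: mul_assoc)
qed (simp add: closed ab x)

section \<open>Two structures with a common unit\<close>

locale unital_structure = second_structure A e mul star
  for A :: "('h::complex_hilbert_space \<Rightarrow>\<^sub>L 'h) set" and e :: "'h \<Rightarrow>\<^sub>L 'h"
    and mul :: "('h \<Rightarrow>\<^sub>L 'h) \<Rightarrow> ('h \<Rightarrow>\<^sub>L 'h) \<Rightarrow> ('h \<Rightarrow>\<^sub>L 'h)" (infixl "\<odot>" 70)
    and star :: "('h \<Rightarrow>\<^sub>L 'h) \<Rightarrow> ('h \<Rightarrow>\<^sub>L 'h)" +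
  assumes e_mul: "a \<in> A \<Longrightarrow> e \<odot> a = a" and mul_e: "a \<in> A \<Longrightarrow> a \<odot> e = a"
begin

text \<open>With \<open>e\<close> a unit for \<open>\<odot>\<close>,
  \<open>self_adjoint_mul_e\<close> makes \<open>star\<close>-fixed elements self-adjoint operators;
  \<open>adjoint_eqI\<close> extends this to all of \<open>A\<close>.\<close>

lemma star_eq_adjoint:
  assumes a: "a \<in> A"
  shows "star a = adjoint_op a"
proof -
  have sa: "adjoint_op s = s" if "s \<in> A" "star s = s" for s
    using self_adjoint_mul_e[OF that] that by (simp add: mul_e)
  have "adjoint_op a = star a"
  proof (rule adjoint_eqI)
    show "adjoint_op (a + star a) = a + star a"
      using a by (intro sa) (simp_all add: closed star_simps add.commute)
    show "adjoint_op (ii (a - star a)) = ii (a - star a)"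
      using a by (intro sa) (simp_all add: closed star_simps ii_simps)
  qed (simp_all add: a closed)
  then show ?thesis by simp
qed

lemma adjoint_mul: "a \<in> A \<Longrightarrow> b \<in> A \<Longrightarrow> adjoint_op (a \<odot> b) = adjoint_op b \<odot> adjoint_op a"
  by (simp add: star_eq_adjoint[symmetric] closed star_simps)

lemma form_square_self_adjoint:
  assumes s: "s \<in> A" "adjoint_op s = s"
  shows "Re (cinner x (blinfun_apply s (blinfun_apply s x))) = (norm (blinfun_apply s x))\<^sup>2"
  using cinner_adjoint_left[OF bounded[OF s(1)], of x "blinfun_apply s x"] s(2)
    Re_cinner_self[of "blinfun_apply s x"]
  by simp

text \<open>The two squares have equal quadratic forms. One inequality is
  \<open>form_square_mul_e\<close>; the other exchanges the roles of the two structures.\<close>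

lemma square_self_adjoint:
  assumes s: "s \<in> A" "adjoint_op s = s"
  shows "s \<odot> s = s o\<^sub>L s"
proof (rule form_determines)
  define S where "S = s o\<^sub>L s"
  have star_s: "star s = s" and star_S: "star S = S" and star_e: "star e = e"
    and S: "S \<in> A" "s o\<^sub>L s = S" "s o\<^sub>L e = s"
    using s e_closed by (simp_all add: S_def star_eq_adjoint Op.closed Op.star_simps e_right adjoint_e)
  fix x assume x: "blinfun_apply e x = x"
  have "(norm (blinfun_apply s x))\<^sup>2 \<le> Re (cinner x (blinfun_apply (s \<odot> s) x))"
    using form_square_mul_e[OF s(1) star_s x] s(1) by (simp add: mul_e)
  \<comment> \<open>The operator structure bounds \<open>norm y\<close> for the rotated element
    \<open>y\<close>, while the second structure computes its square as the norm of
    \<open>star y \<odot> y\<close>, which is \<open>e - t^2 (S - s \<odot> s)\<close> up to order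
    \<open>t^3\<close>.\<close>
  moreover have "0 \<le> Re (cinner x (blinfun_apply (S - s \<odot> s) x))"
  proof (rule form_nonnegI[OF _ x])
    define K where "K = norm (e o\<^sub>L (s o\<^sub>L (s o\<^sub>L S))) / 4"
    define X where "X = ii (s \<odot> S - S \<odot> s)"
    fix t :: real assume t: "0 < t" "t \<le> 1"
    define y where "y = e + t *\<^sub>R ii s - (t\<^sup>2 / 2) *\<^sub>R S"
    have y: "y \<in> A"
      using s S e_closed by (simp add: y_def closed)
    have "(norm y)\<^sup>2 \<le> 1 + K * t ^ 4"
      using Op.norm_rotate_second_order[OF s(1) e_closed s(2), of t] norm_e_square_le
      by (simp add: S y_def K_def adjoint_e)
    moreover have "star y \<odot> y = (e - t\<^sup>2 *\<^sub>R (S - s \<odot> s)) + ((t ^ 3 / 2) *\<^sub>R X + (t ^ 4 / 4) *\<^sub>R (S \<odot> S))"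
      using s S e_closed
      by (simp add: y_def X_def star_simps star_s star_S star_e closed mul_simps ii_simps e_mul mul_e
          power2_eq_square power3_eq_cube power4_eq_xxxx algebra_simps)
        (simp flip: scaleR_add_left)
    moreover have "norm (star y \<odot> y) = (norm y)\<^sup>2"
      by (rule cstar_identity[OF y])
    ultimately have "norm (e - t\<^sup>2 *\<^sub>R (S - s \<odot> s)) \<le> 1 + K * t ^ 4 + norm ((t ^ 3 / 2) *\<^sub>R X + (t ^ 4 / 4) *\<^sub>R (S \<odot> S))"
      using norm_triangle_ineq4[of "star y \<odot> y" "(t ^ 3 / 2) *\<^sub>R X + (t ^ 4 / 4) *\<^sub>R (S \<odot> S)"] by simp
    also have "\<dots> \<le> 1 + K * t ^ 4 + (t ^ 3 / 2 * norm X + t ^ 4 / 4 * norm (S \<odot> S))"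
      using t norm_triangle_ineq[of "(t ^ 3 / 2) *\<^sub>R X" "(t ^ 4 / 4) *\<^sub>R (S \<odot> S)"] by simp
    also have "\<dots> \<le> 1 + K * t ^ 3 + (t ^ 3 / 2 * norm X + t ^ 3 / 4 * norm (S \<odot> S))"
      using t power_decreasing[of 3 4 t]
      by (intro add_mono mult_left_mono mult_right_mono divide_right_mono order_refl) (auto simp: K_def)
    also have "\<dots> = 1 + (K + norm X / 2 + norm (S \<odot> S) / 4) * t ^ 3"
      by (simp add: algebra_simps)
    finally show "norm (e - t\<^sup>2 *\<^sub>R (S - s \<odot> s)) \<le> 1 + (norm (e o\<^sub>L (s o\<^sub>L (s o\<^sub>L S))) / 4
        + norm (ii (s \<odot> S - S \<odot> s)) / 2 + norm (S \<odot> S) / 4) * t ^ 3"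
      by (simp only: K_def X_def)
  qed
  ultimately show "Re (cinner x (blinfun_apply (s \<odot> s) x)) = Re (cinner x (blinfun_apply (s o\<^sub>L s) x))"
    by (simp add: form_square_self_adjoint s S_def blinfun_simps cinner.diff_right)
qed (use s in \<open>simp_all add: closed Op.closed Op.star_simps adjoint_mul\<close>)

section \<open>Agreement of squares, Jordan products and triple products\<close>

lemmas Op_simps = Op.mul_simps Op.mul_assoc

text \<open>For \<open>a = s + ii k\<close> with self-adjoint \<open>s\<close> and \<open>k\<close>,
  only the mixed term \<open>s k + k s\<close> is new; squaring \<open>s + k\<close> provides
  it.\<close>

lemma square: 
  assumes a: "a \<in> A"
  shows "a \<odot> a = a o\<^sub>L a"
proof -
  define s k where "s = (1/2) *\<^sub>R (a + adjoint_op a)" and "k = (1/2) *\<^sub>R ii (adjoint_op a - a)"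
  have s: "s \<in> A" "adjoint_op s = s" and k: "k \<in> A" "adjoint_op k = k"
    using a by (simp_all add: s_def k_def Op.closed Op.star_simps ii_simps add.commute)
  have a_eq: "a = s + ii k"
    by (simp add: s_def k_def ii_simps algebra_simps flip: scaleR_add_left)
  have "(s + k) \<odot> (s + k) = (s + k) o\<^sub>L (s + k)"
    using s k by (intro square_self_adjoint) (simp_all add: Op.closed Op.star_simps)
  then have "s \<odot> k + k \<odot> s = (s o\<^sub>L k) + (k o\<^sub>L s)"
    using s k by (simp add: mul_simps Op.mul_simps closed square_self_adjoint algebra_simps)
  then have "ii (s \<odot> k) + ii (k \<odot> s) = ii (s o\<^sub>L k) + ii (k o\<^sub>L s)"
    by (simp flip: op_scale_add_right)
  then show ?thesis
    unfolding a_eq using s k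
    by (simp add: mul_simps Op.mul_simps closed square_self_adjoint ii_simps algebra_simps)
qed

lemma jordan:
  assumes "a \<in> A" "b \<in> A"
  shows "a \<odot> b + b \<odot> a = (a o\<^sub>L b) + (b o\<^sub>L a)"
  using square[of "a + b"] square[of a] square[of b] assms
  by (simp add: mul_simps Op.mul_simps closed algebra_simps)

text \<open>Triple products are Jordan expressions:
  \<open>2 a b a = a (a b + b a) + (a b + b a) a - (a^2 b + b a^2)\<close>.\<close>

lemma triple:
  assumes a: "a \<in> A" "b \<in> A"
  shows "a \<odot> (b \<odot> a) = a o\<^sub>L (b o\<^sub>L a)"
proof -
  let ?j = "(a o\<^sub>L b) + (b o\<^sub>L a)"
  have j: "?j \<in> A" using a by (simp add: Op.closed)
  have "2 *\<^sub>R (a \<odot> (b \<odot> a)) = (a \<odot> (a \<odot> b + b \<odot> a) + (a \<odot> b + b \<odot> a) \<odot> a) - (a \<odot> a \<odot> b + b \<odot> (a \<odot> a))"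
    using a by (simp add: mul_simps closed mul_assoc scaleR_2)
  also have "\<dots> = (a \<odot> ?j + ?j \<odot> a) - ((a o\<^sub>L a) \<odot> b + b \<odot> (a o\<^sub>L a))"
    by (simp only: jordan[OF a] square[OF a(1)])
  also have "\<dots> = ((a o\<^sub>L ?j) + (?j o\<^sub>L a)) - (((a o\<^sub>L a) o\<^sub>L b) + (b o\<^sub>L (a o\<^sub>L a)))"
    using a j by (simp only: jordan Op.mul_closed)
  also have "\<dots> = 2 *\<^sub>R (a o\<^sub>L (b o\<^sub>L a))"
    using a by (simp add: Op_simps Op.closed scaleR_2)
  finally show ?thesis by simp
qed

lemma triple_linear:
  assumes a: "a \<in> A" "b \<in> A" "c \<in> A"
  shows "a \<odot> (b \<odot> c) + c \<odot> (b \<odot> a) = (a o\<^sub>L (b o\<^sub>L c)) + (c o\<^sub>L (b o\<^sub>L a))"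
  using triple[of "a + c" b] triple[of a b] triple[of c b] a
  by (simp add: mul_simps Op.mul_simps closed Op.closed algebra_simps)

text \<open>\<open>D\<close> measures the failure of the identity to be a homomorphism between the two products, \<open>E\<close>
  its failure to be an antihomomorphism.\<close>

definition D :: "('h \<Rightarrow>\<^sub>L 'h) \<Rightarrow> ('h \<Rightarrow>\<^sub>L 'h) \<Rightarrow> ('h \<Rightarrow>\<^sub>L 'h)" where
  "D a b = a \<odot> b - (a o\<^sub>L b)"

definition E :: "('h \<Rightarrow>\<^sub>L 'h) \<Rightarrow> ('h \<Rightarrow>\<^sub>L 'h) \<Rightarrow> ('h \<Rightarrow>\<^sub>L 'h)" where
  "E a b = a \<odot> b - (b o\<^sub>L a)"

lemma DE_closed: "a \<in> A \<Longrightarrow> b \<in> A \<Longrightarrow> D a b \<in> A" "a \<in> A \<Longrightarrow> b \<in> A \<Longrightarrow> E a b \<in> A"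
  by (simp_all add: D_def E_def closed Op.closed)

lemma DE_add:
  assumes "a \<in> A" "b \<in> A" "c \<in> A"
  shows "D (a + c) b = D a b + D c b" "D b (a + c) = D b a + D b c"
    "E (a + c) b = E a b + E c b" "E b (a + c) = E b a + E b c"
  using assms by (simp_all add: D_def E_def mul_simps Op.mul_simps algebra_simps)

text \<open>Herstein: \<open>a \<odot> b \<odot> x \<odot> b \<odot> a + b \<odot> a \<odot> x \<odot> a \<odot> b\<close> is computed in two ways from the fact that both
  products have the same triple products.\<close>

lemma D_E_symmetric_zero:
  assumes a: "a \<in> A" "b \<in> A" "x \<in> A"
  shows "(D a b o\<^sub>L x o\<^sub>L E a b) + (E a b o\<^sub>L x o\<^sub>L D a b) = 0"
proof -
  define \<alpha> \<beta> where "\<alpha> = a \<odot> b" and "\<beta> = b \<odot> a"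
  note [simp] = a closed Op.closed
  have ab[simp]: "\<alpha> \<in> A" "\<beta> \<in> A" by (simp_all add: \<alpha>_def \<beta>_def)
  have \<beta>: "\<beta> = (a o\<^sub>L b) + (b o\<^sub>L a) - \<alpha>"
    using jordan[of a b] by (simp add: \<alpha>_def \<beta>_def algebra_simps)
  have "(\<alpha> o\<^sub>L (x o\<^sub>L \<beta>)) + (\<beta> o\<^sub>L (x o\<^sub>L \<alpha>)) = \<alpha> \<odot> (x \<odot> \<beta>) + \<beta> \<odot> (x \<odot> \<alpha>)"
    by (simp add: triple_linear)
  also have "\<dots> = a \<odot> ((b \<odot> (x \<odot> b)) \<odot> a) + b \<odot> ((a \<odot> (x \<odot> a)) \<odot> b)"
    by (simp add: \<alpha>_def \<beta>_def mul_assoc)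
  also have "\<dots> = (a o\<^sub>L (b o\<^sub>L (x o\<^sub>L (b o\<^sub>L a)))) + (b o\<^sub>L (a o\<^sub>L (x o\<^sub>L (a o\<^sub>L b))))"
    by (simp only: triple a closed Op.closed) (simp add: Op.mul_assoc)
  finally show ?thesis
    unfolding D_def E_def \<alpha>_def[symmetric] \<beta> by (simp add: Op_simps algebra_simps)
qed

text \<open>Semiprimeness of the operator product separates the two halves of the symmetric
  relation.\<close>

lemma D_E_same:
  assumes "a \<in> A" "b \<in> A" "x \<in> A"
  shows "D a b o\<^sub>L x o\<^sub>L E a b = 0" "E a b o\<^sub>L x o\<^sub>L D a b = 0"
  using Op.mul_mul_zero_if_symmetric_zero[of "D a b" "E a b" x] D_E_symmetric_zero[OF assms(1,2)]
    D_E_symmetric_zero[OF assms] assms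
  by (simp_all add: DE_closed)

text \<open>Linearizing \<open>D_E_same\<close> in the first argument gives
  \<open>?S = - ?S'\<close>. Substituting this for the second \<open>?S\<close> in the product of
  \<open>?S\<close>, \<open>y\<close>, \<open>?S\<close> puts \<open>E c b\<close> and
  \<open>D c b\<close> around \<open>y\<close>, which gives zero; semiprimeness then removes
  \<open>?S\<close>. The argument for \<open>?T\<close> is analogous.\<close>

lemma D_E_same_right:
  assumes a: "a \<in> A" "b \<in> A" "c \<in> A" and x: "x \<in> A"
  shows "D a b o\<^sub>L x o\<^sub>L E c b = 0" "E c b o\<^sub>L x o\<^sub>L D a b = 0"
proof -
  note [simp] = a x closed Op.closed DE_closed
  have D: "D a b o\<^sub>L x o\<^sub>L E c b = - (D c b o\<^sub>L x o\<^sub>L E a b)" (is "?S = - ?S'")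
    and E: "E c b o\<^sub>L x o\<^sub>L D a b = - (E a b o\<^sub>L x o\<^sub>L D c b)" (is "?T = - ?T'")
    using D_E_same[of "a + c" b x] D_E_same[of a b x] D_E_same[of c b x]
    by (simp_all add: DE_add Op_simps add_eq_0_iff2 add.commute)
  show "?S = 0"
  proof (rule Op.zero_if_mul_self_zero)
    fix y assume [simp]: "y \<in> A"
    have "?S o\<^sub>L (y o\<^sub>L ?S) = ?S o\<^sub>L (y o\<^sub>L - ?S')"
      by (rule arg_cong[OF D, of "\<lambda>z. ?S o\<^sub>L (y o\<^sub>L z)"])
    also have "\<dots> = - (D a b o\<^sub>L x o\<^sub>L (E c b o\<^sub>L y o\<^sub>L D c b) o\<^sub>L (x o\<^sub>L E a b))"
      by (simp add: Op_simps)
    also have "\<dots> = 0"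
      by (simp add: D_E_same Op.mul_zero_left Op.mul_zero_right)
    finally show "?S o\<^sub>L (y o\<^sub>L ?S) = 0" .
  qed simp
  show "?T = 0"
  proof (rule Op.zero_if_mul_self_zero)
    fix y assume [simp]: "y \<in> A"
    have "?T o\<^sub>L (y o\<^sub>L ?T) = ?T o\<^sub>L (y o\<^sub>L - ?T')"
      by (rule arg_cong[OF E, of "\<lambda>z. ?T o\<^sub>L (y o\<^sub>L z)"])
    also have "\<dots> = - (E c b o\<^sub>L x o\<^sub>L (D a b o\<^sub>L y o\<^sub>L E a b) o\<^sub>L (x o\<^sub>L D c b))"
      by (simp add: Op_simps)
    also have "\<dots> = 0"
      by (simp add: D_E_same Op.mul_zero_left Op.mul_zero_right)
    finally show "?T o\<^sub>L (y o\<^sub>L ?T) = 0" .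
  qed simp
qed

text \<open>The same device in the second arguments: \<open>b\<close> is linearized to
  \<open>b + d\<close>, and \<open>D_E_same_right\<close> kills the middle factor.\<close>

lemma E_D_zero:
  assumes a: "a \<in> A" "b \<in> A" "c \<in> A" "d \<in> A" and x: "x \<in> A"
  shows "E c d o\<^sub>L x o\<^sub>L D a b = 0" (is "?T = 0")
proof (rule Op.zero_if_mul_self_zero)
  note [simp] = a x closed Op.closed DE_closed
  have E: "?T = - (E c b o\<^sub>L x o\<^sub>L D a d)" (is "_ = - ?T'")
    using D_E_same_right(2)[of a "b + d" c x] D_E_same_right(2)[of a b c x] D_E_same_right(2)[of a d c x]
    by (simp add: DE_add Op_simps add_eq_0_iff2 add.commute)
  fix y assume [simp]: "y \<in> A"
  have "?T o\<^sub>L (y o\<^sub>L ?T) = ?T o\<^sub>L (y o\<^sub>L - ?T')"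
    by (rule arg_cong[OF E, of "\<lambda>z. ?T o\<^sub>L (y o\<^sub>L z)"])
  also have "\<dots> = - (E c d o\<^sub>L x o\<^sub>L (D a b o\<^sub>L y o\<^sub>L E c b) o\<^sub>L (x o\<^sub>L D a d))"
    by (simp add: Op_simps)
  also have "\<dots> = 0"
    by (simp add: D_E_same_right Op.mul_zero_left Op.mul_zero_right)
  finally show "?T o\<^sub>L (y o\<^sub>L ?T) = 0" .
qed (simp add: a x Op.closed DE_closed)

end

section \<open>Commutants and the central projection\<close>

lemmas compose_diff = bounded_bilinear.diff_left[OF bounded_bilinear_blinfun_compose]
  bounded_bilinear.diff_right[OF bounded_bilinear_blinfun_compose]

lemma id_blinfun_compose: "id_blinfun o\<^sub>L T = T" "T o\<^sub>L id_blinfun = T"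
  by (rule blinfun_eqI, simp)+

lemma commutantI:
  assumes "B \<in> bounded_operators" and "\<And>T. T \<in> S \<Longrightarrow> T o\<^sub>L B = B o\<^sub>L T"
  shows "B \<in> commutant S"
  using assms by (simp add: commutant_def)

lemma commutantD:
  assumes "B \<in> commutant S"
  shows "B \<in> bounded_operators" and "T \<in> S \<Longrightarrow> T o\<^sub>L B = B o\<^sub>L T"
  using assms by (simp_all add: commutant_def)

lemma (in operator_algebra) adjoint_in_commutant:
  assumes B: "B \<in> commutant A"
  shows "adjoint_op B \<in> commutant A"
proof (rule commutantI)
  fix T assume T: "T \<in> A"
  have "adjoint_op (adjoint_op T o\<^sub>L B) = adjoint_op (B o\<^sub>L adjoint_op T)"
    using commutantD(2)[OF B Op.star_closed[OF T]] by simp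
  then show "T o\<^sub>L adjoint_op B = adjoint_op B o\<^sub>L T"
    using T commutantD(1)[OF B]
    by (simp add: adjoint_compose bounded Op.star_closed Op.star_star)
qed (intro adjoint_in_bounded_operators commutantD(1)[OF B])

context unital_structure
begin

text \<open>The adjoint reverses both products, so adjoints of values of \<open>E\<close> are again
  values of \<open>E\<close> and annihilate the subspace used in
  \<open>central_decomposition\<close>.\<close>

lemma adjoint_E: "a \<in> A \<Longrightarrow> b \<in> A \<Longrightarrow> adjoint_op (E a b) = E (adjoint_op b) (adjoint_op a)"
  by (simp add: E_def Op.star_simps Op.closed closed adjoint_mul)

text \<open>The complement of \<open>p\<close> projects onto the vectors annihilated by all \<open>E c d a\<close>. By the
  orthogonality of \<open>E\<close> and \<open>D\<close> it contains the range of every \<open>D a b\<close>.\<close>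

lemma central_decomposition:
  "\<exists>p. central_projection (commutant (commutant A)) p \<and>
    (\<forall>a\<in>A. \<forall>b\<in>A. a \<odot> b = (p o\<^sub>L a o\<^sub>L b) + ((e - p) o\<^sub>L b o\<^sub>L a))"
proof -
  \<comment> \<open>The factor \<open>a\<close> makes \<open>M\<close> invariant under
    \<open>A\<close>; the case \<open>a = e\<close> says that every \<open>E c d\<close> annihilates
    \<open>x\<close>.\<close>
  define M where "M = {x. \<forall>a\<in>A. \<forall>c\<in>A. \<forall>d\<in>A. blinfun_apply (E c d) (blinfun_apply a x) = 0}"
  interpret closed_csubspace M
  proof
    show "closed M"
    proof -
      have "M = (\<Inter>a\<in>A. \<Inter>c\<in>A. \<Inter>d\<in>A. {x. blinfun_apply (E c d) (blinfun_apply a x) = 0})"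
        by (auto simp: M_def)
      then show ?thesis
        by (simp only:) (intro closed_INT ballI closed_Collect_eq continuous_intros)
    qed
    show "c *\<^sub>C x \<in> M" if "x \<in> M" for c x
    proof -
      have "blinfun_apply (E d d') (blinfun_apply a (c *\<^sub>C x)) = c *\<^sub>C blinfun_apply (E d d') (blinfun_apply a x)"
        if "a \<in> A" "d \<in> A" "d' \<in> A" for a d d'
        using that by (simp add: bounded_operatorsD bounded DE_closed)
      moreover have "c *\<^sub>C 0 = (0::'h)"
        using scaleC_diff_right[of c "0::'h" 0] by simp
      ultimately show ?thesis using that by (simp add: M_def)
    qed
  qed (simp_all add: M_def blinfun_simps)
  obtain r where r: "r \<in> bounded_operators" "adjoint_op r = r" "\<And>x. blinfun_apply r x \<in> M"
      "\<And>x. x \<in> M \<Longrightarrow> blinfun_apply r x = x"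
    using projection_exists by blast
  have rr: "r o\<^sub>L r = r"
    by (rule blinfun_eqI) (simp add: r)
  have inv_A: "blinfun_apply T x \<in> M" if "T \<in> A" "x \<in> M" for T x
    unfolding M_def
  proof (intro CollectI ballI)
    fix a c d assume "a \<in> A" "c \<in> A" "d \<in> A"
    moreover from this that have "blinfun_apply (E c d) (blinfun_apply (a o\<^sub>L T) x) = 0"
      unfolding M_def by (blast intro: Op.mul_closed)
    ultimately show "blinfun_apply (E c d) (blinfun_apply a (blinfun_apply T x)) = 0" by simp
  qed
  have inv_commutant: "blinfun_apply B x \<in> M" if B: "B \<in> commutant A" and x: "x \<in> M" for B x
    unfolding M_def
  proof (intro CollectI ballI)
    fix a c d assume a: "a \<in> A" "c \<in> A" "d \<in> A"
    then have "(E c d o\<^sub>L a) o\<^sub>L B = B o\<^sub>L (E c d o\<^sub>L a)"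
      by (intro commutantD(2)[OF B] Op.mul_closed DE_closed)
    then have "blinfun_apply (E c d) (blinfun_apply a (blinfun_apply B x))
        = blinfun_apply B (blinfun_apply (E c d) (blinfun_apply a x))"
      by (metis blinfun_apply_blinfun_compose)
    then show "blinfun_apply (E c d) (blinfun_apply a (blinfun_apply B x)) = 0"
      using x a by (simp add: M_def blinfun_simps)
  qed
  \<comment> \<open>\<open>M\<close> is invariant under \<open>A\<close> and under its commutant,
    and both are closed under adjoints, so \<open>r\<close> commutes with both.\<close>
  have r_commutant: "r \<in> commutant A"
    by (rule commutantI[OF r(1)], rule projection_commute[OF r, symmetric])
      (simp_all add: bounded inv_A Op.star_closed)
  have r_bicommutant: "r \<in> commutant (commutant A)"
    by (rule commutantI[OF r(1)], rule projection_commute[OF r, symmetric])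
      (simp_all add: commutantD inv_commutant adjoint_in_commutant)
  \<comment> \<open>The complement is taken in the identity operator; on ranges of elements of
    \<open>A\<close>, which \<open>e\<close> fixes, \<open>e - p\<close> still acts as
    \<open>r\<close>.\<close>
  define p where "p = id_blinfun - r"
  have "central_projection (commutant (commutant A)) p"
    unfolding central_projection_def
  proof (intro conjI ballI)
    show "p \<in> commutant (commutant A)"
      unfolding p_def
      by (intro commutantI diff_in_bounded_operators id_in_bounded_operators r(1))
        (simp add: commutantD(2)[OF r_bicommutant] compose_diff id_blinfun_compose)
    show "adjoint_op p = p"
      using cinner_adjoint_left[OF r(1)] r(2)
      by (intro adjoint_opI) (simp add: p_def blinfun_simps cinner.diff_left cinner.diff_right)
    show "p o\<^sub>L p = p"
      by (simp add: p_def compose_diff id_blinfun_compose rr)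
    fix b assume "b \<in> commutant (commutant A)"
    from commutantD(2)[OF this r_commutant] show "p o\<^sub>L b = b o\<^sub>L p"
      by (simp add: p_def compose_diff id_blinfun_compose)
  qed
  \<comment> \<open>From \<open>r D = D\<close> and \<open>r E = 0\<close> follows
    \<open>a \<odot> b = a b - r a b + r b a\<close>, which is the claimed formula.\<close>
  moreover have "a \<odot> b = (p o\<^sub>L a o\<^sub>L b) + ((e - p) o\<^sub>L b o\<^sub>L a)" if a: "a \<in> A" "b \<in> A" for a b
  proof (rule blinfun_eqI)
    fix x
    have "blinfun_apply (D a b) x \<in> M"
      unfolding M_def
    proof (intro CollectI ballI)
      fix f c d assume "f \<in> A" "c \<in> A" "d \<in> A"
      from E_D_zero[OF a this(2,3,1)]
      show "blinfun_apply (E c d) (blinfun_apply f (blinfun_apply (D a b) x)) = 0"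
        by (metis blinfun.zero_left blinfun_apply_blinfun_compose)
    qed
    then have rD: "blinfun_apply r (blinfun_apply (D a b) x) = blinfun_apply (D a b) x"
      by (rule r(4))
    have E: "E a b \<in> bounded_operators" "E a b \<in> A" "E (adjoint_op b) (adjoint_op a) \<in> A"
      using a by (simp_all add: DE_closed bounded Op.star_closed)
    have "cinner y (blinfun_apply r (blinfun_apply (E a b) x)) = 0" for y
    proof -
      have "cinner y (blinfun_apply r (blinfun_apply (E a b) x))
          = cinner (blinfun_apply (adjoint_op (E a b)) (blinfun_apply r y)) x"
        using cinner_adjoint_left[OF r(1)] r(2) cinner_adjoint_left[OF E(1)] by metis
      \<comment> \<open>Inserting \<open>e\<close> supplies the element of \<open>A\<close> required
        between \<open>E\<close> and the vector in the definition of \<open>M\<close>.\<close>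
      also have "blinfun_apply (adjoint_op (E a b)) (blinfun_apply r y)
          = blinfun_apply (E (adjoint_op b) (adjoint_op a)) (blinfun_apply e (blinfun_apply r y))"
        using e_apply(2)[OF E(3)] adjoint_E[OF a] by simp
      also have "\<dots> = 0"
        using r(3)[of y] a e_closed by (simp add: M_def Op.star_closed)
      finally show ?thesis by (simp add: cinner.zero_left)
    qed
    then have rE: "blinfun_apply r (blinfun_apply (E a b) x) = 0"
      by (metis cinner_self_eq_0)
    have "blinfun_apply e (blinfun_apply b (blinfun_apply a x)) = blinfun_apply b (blinfun_apply a x)"
      by (rule e_apply(1)[OF a(2)])
    then show "blinfun_apply (a \<odot> b) x = blinfun_apply ((p o\<^sub>L a o\<^sub>L b) + ((e - p) o\<^sub>L b o\<^sub>L a)) x"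
      using rD rE by (simp add: D_def E_def p_def blinfun_simps algebra_simps)
  qed
  ultimately show ?thesis by blast
qed

end

section \<open>Reduction to a common unit\<close>

context second_structure
begin

text \<open>In the second structure \<open>e\<close> is unitary; its isotope by \<open>star e\<close> has the same unit as the
  original product.\<close>

definition mul' :: "('h \<Rightarrow>\<^sub>L 'h) \<Rightarrow> ('h \<Rightarrow>\<^sub>L 'h) \<Rightarrow> ('h \<Rightarrow>\<^sub>L 'h)" where
  "mul' a b = a \<odot> (star e \<odot> b)"

definition star' :: "('h \<Rightarrow>\<^sub>L 'h) \<Rightarrow> ('h \<Rightarrow>\<^sub>L 'h)" where
  "star' a = e \<odot> (star a \<odot> e)"

lemma e_star_e:
  "e \<odot> star e = one" "star e \<odot> e = one"
  "a \<in> A \<Longrightarrow> e \<odot> (star e \<odot> a) = a" "a \<in> A \<Longrightarrow> star e \<odot> (e \<odot> a) = a"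
  using one_left[of a] mul_assoc[of e "star e" a] mul_assoc[of "star e" e a]
  by (simp_all add: one_def[symmetric] star_e_mul_e e_closed closed)

lemma norm_unitary_mul: "a \<in> A \<Longrightarrow> norm (e \<odot> a) = norm a" "a \<in> A \<Longrightarrow> norm (star e \<odot> a) = norm a"
proof -
  have "(norm (e \<odot> a))\<^sup>2 = (norm a)\<^sup>2" "(norm (star e \<odot> a))\<^sup>2 = (norm a)\<^sup>2" if "a \<in> A" for a
    using cstar_identity[of "e \<odot> a"] cstar_identity[of "star e \<odot> a"] cstar_identity[of a] that
    by (simp_all add: closed e_closed star_simps mul_assoc e_star_e)
  then show "a \<in> A \<Longrightarrow> norm (e \<odot> a) = norm a" "a \<in> A \<Longrightarrow> norm (star e \<odot> a) = norm a"
    by simp_all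
qed

text \<open>The product \<open>mul' (star' a) a\<close> collapses to
  \<open>e \<odot> (star a \<odot> a)\<close>, so the C*-identity is inherited because
  multiplication by \<open>e\<close> is isometric.\<close>

lemma unital_structure_mul': "unital_structure A e mul' star'"
proof
  note [simp] = closed star_simps e_closed mul_assoc e_star_e mul_simps one_left one_right
  show "norm (mul' a b) \<le> norm a * norm b" if "a \<in> A" "b \<in> A" for a b
    using norm_mul_le[of a "star e \<odot> b"] that by (simp add: mul'_def norm_unitary_mul)
  show "norm (mul' (star' a) a) = (norm a)\<^sup>2" if "a \<in> A" for a
    using that by (simp add: mul'_def star'_def norm_unitary_mul flip: cstar_identity)
qed (simp_all add: mul'_def star'_def closed star_simps e_closed mul_assoc e_star_e mul_simps
    one_left one_right op_scale_add_right op_scale_op_scale zero_closed smul_add_left smul_of_real norm_smul complete_carrier star_smul)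

lemma decomposition:
  "\<exists>u\<in>A. \<exists>p. adjoint_op u o\<^sub>L u = e \<and> u o\<^sub>L adjoint_op u = e \<and>
    central_projection (commutant (commutant A)) p \<and>
    (\<forall>a\<in>A. \<forall>b\<in>A. a \<odot> b = (p o\<^sub>L a o\<^sub>L u o\<^sub>L b) + ((e - p) o\<^sub>L b o\<^sub>L u o\<^sub>L a)) \<and>
    (\<forall>a\<in>A. star a = adjoint_op u o\<^sub>L adjoint_op a o\<^sub>L adjoint_op u)"
proof -
  interpret U: unital_structure A e mul' star'
    by (rule unital_structure_mul')
  note [simp] = closed e_closed one_closed
  define u where "u = adjoint_op one"
  have u: "u \<in> A" and adj_u: "adjoint_op u = one"
    by (simp_all add: u_def Op.star_closed Op.star_star)
  have u_eq: "u = e \<odot> e"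
    using U.star_eq_adjoint[of one] by (simp add: u_def star'_def star_one one_left)
  \<comment> \<open>\<open>u\<close> is the inverse of \<open>one\<close> for \<open>mul'\<close>;
    equality of Jordan products transfers this in symmetrized form to operators.\<close>
  have "(one o\<^sub>L u) + (u o\<^sub>L one) = mul' one u + mul' u one"
    using U.jordan[of one u] u by simp
  also have "\<dots> = e + e"
    by (simp add: mul'_def u_eq mul_assoc e_star_e one_left one_right)
  finally have sum: "(one o\<^sub>L u) + (u o\<^sub>L one) = e + e" .
  have norm_le: "(norm one)\<^sup>2 \<le> 1" "(norm u)\<^sup>2 \<le> 1"
    using norm_one_le by (simp_all add: u_def Op.norm_star power_le_one)
  \<comment> \<open>By \<open>sum\<close>, the squared norms of \<open>u x\<close> and
    \<open>one x\<close> add up to twice that of \<open>x\<close>. Neither exceeds it, so both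
    attain it.\<close>
  have one_u: "one o\<^sub>L u = e"
  proof (rule form_determines)
    fix x assume x: "blinfun_apply e x = x"
    have "cinner x (blinfun_apply (one o\<^sub>L u) x) = complex_of_real ((norm (blinfun_apply u x))\<^sup>2)"
      "cinner x (blinfun_apply (u o\<^sub>L one) x) = complex_of_real ((norm (blinfun_apply one x))\<^sup>2)"
      using cinner_adjoint_right[OF bounded[OF u], of x] cinner_adjoint_right[OF bounded[OF one_closed], of x]
      by (simp_all add: adj_u cinner_self flip: u_def)
    then have "Re (cinner x (blinfun_apply (one o\<^sub>L u) x)) = (norm (blinfun_apply u x))\<^sup>2"
      "Re (cinner x (blinfun_apply (u o\<^sub>L one) x)) = (norm (blinfun_apply one x))\<^sup>2"
      by (simp_all only: Re_complex_of_real)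
    moreover have "Re (cinner x (blinfun_apply (one o\<^sub>L u) x)) + Re (cinner x (blinfun_apply (u o\<^sub>L one) x))
        = Re (cinner x (blinfun_apply (e + e) x))"
      unfolding sum[symmetric] by (simp only: blinfun.add_left cinner.add_right plus_complex.sel)
    moreover have "(norm (blinfun_apply u x))\<^sup>2 \<le> 1 * (norm x)\<^sup>2" "(norm (blinfun_apply one x))\<^sup>2 \<le> 1 * (norm x)\<^sup>2"
      by (intro norm_square_apply_le norm_le)+
    moreover have "Re (cinner x (blinfun_apply (e + e) x)) = 2 * (norm x)\<^sup>2"
      "Re (cinner x (blinfun_apply e x)) = (norm x)\<^sup>2"
      by (simp_all add: x blinfun.add_left cinner.add_right Re_cinner_self)
    ultimately show "Re (cinner x (blinfun_apply (one o\<^sub>L u) x)) = Re (cinner x (blinfun_apply e x))"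
      by linarith
  qed (use u in \<open>simp_all add: Op.closed Op.star_mul adj_u adjoint_e flip: u_def\<close>)
  have u_one: "u o\<^sub>L one = e"
    using sum by (simp add: one_u)
  obtain p where p: "central_projection (commutant (commutant A)) p"
    and mul': "\<And>a b. a \<in> A \<Longrightarrow> b \<in> A \<Longrightarrow> mul' a b = (p o\<^sub>L a o\<^sub>L b) + ((e - p) o\<^sub>L b o\<^sub>L a)"
    using U.central_decomposition by blast
  have "A \<subseteq> commutant (commutant A)"
  proof
    fix b assume b: "b \<in> A"
    show "b \<in> commutant (commutant A)"
      by (rule commutantI[OF bounded[OF b]]) (rule commutantD(2)[OF _ b, symmetric])
  qed
  then have p_comm: "b o\<^sub>L p = p o\<^sub>L b" if "b \<in> A" for b
    using p that unfolding central_projection_def by (metis subsetD)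
  have pp: "p o\<^sub>L p = p"
    using p unfolding central_projection_def by blast
  have mul_eq: "a \<odot> b = (p o\<^sub>L a o\<^sub>L u o\<^sub>L b) + ((e - p) o\<^sub>L b o\<^sub>L u o\<^sub>L a)" if a: "a \<in> A" "b \<in> A" for a b
  proof (rule blinfun_eqI)
    fix x
    \<comment> \<open>The middle factor \<open>u = e \<odot> e\<close> cancels the two factors
      \<open>star e\<close> of the isotope.\<close>
    have "a \<odot> b = mul' (mul' a u) b"
      using a by (simp add: mul'_def u_eq mul_assoc e_star_e)
    also have "\<dots> = (p o\<^sub>L mul' a u o\<^sub>L b) + ((e - p) o\<^sub>L b o\<^sub>L mul' a u)"
      using a u by (intro mul' U.mul_closed)
    also have "mul' a u = (p o\<^sub>L a o\<^sub>L u) + ((e - p) o\<^sub>L u o\<^sub>L a)"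
      using a u by (intro mul')
    finally have *: "a \<odot> b = (p o\<^sub>L ((p o\<^sub>L a o\<^sub>L u) + ((e - p) o\<^sub>L u o\<^sub>L a)) o\<^sub>L b)
        + ((e - p) o\<^sub>L b o\<^sub>L ((p o\<^sub>L a o\<^sub>L u) + ((e - p) o\<^sub>L u o\<^sub>L a)))" .
    \<comment> \<open>Idempotence of \<open>p\<close> and its commuting with \<open>A\<close> remove
      the mixed terms containing \<open>p\<close> and \<open>e - p\<close>.\<close>
    have "blinfun_apply c (blinfun_apply p y) = blinfun_apply p (blinfun_apply c y)" if "c \<in> A" for c y
      using p_comm[OF that] by (metis blinfun_apply_blinfun_compose)
    moreover have "blinfun_apply p (blinfun_apply p y) = blinfun_apply p y" for y
      using pp by (metis blinfun_apply_blinfun_compose)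
    ultimately show "blinfun_apply (a \<odot> b) x
        = blinfun_apply ((p o\<^sub>L a o\<^sub>L u o\<^sub>L b) + ((e - p) o\<^sub>L b o\<^sub>L u o\<^sub>L a)) x"
      unfolding * using a u by (simp add: blinfun_simps e_apply)
  qed
  have star_eq: "star a = adjoint_op u o\<^sub>L adjoint_op a o\<^sub>L adjoint_op u" if a: "a \<in> A" for a
  proof -
    \<comment> \<open>As a triple product of the isotope, \<open>star a\<close> can be rewritten
      with operator products by \<open>U.triple\<close>.\<close>
    have "star a = mul' one (mul' (star' a) one)"
      using a by (simp add: mul'_def star'_def mul_assoc e_star_e one_left one_right star_one)
    also have "\<dots> = one o\<^sub>L (adjoint_op a o\<^sub>L one)"
      using a U.triple[of one "adjoint_op a"] by (simp add: U.star_eq_adjoint Op.star_closed)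
    finally show ?thesis
      using a by (simp add: adj_u Op.mul_assoc Op.closed)
  qed
  show ?thesis
    using u p one_u u_one mul_eq star_eq adj_u by (intro bexI[of _ u] exI[of _ p]) auto
qed

end

theorem theorem2p2:
  fixes A :: "('h::complex_hilbert_space \<Rightarrow>\<^sub>L 'h) set"
    and e :: "'h \<Rightarrow>\<^sub>L 'h"
    and mul :: "('h \<Rightarrow>\<^sub>L 'h) \<Rightarrow> ('h \<Rightarrow>\<^sub>L 'h) \<Rightarrow> ('h \<Rightarrow>\<^sub>L 'h)"
    and star :: "('h \<Rightarrow>\<^sub>L 'h) \<Rightarrow> ('h \<Rightarrow>\<^sub>L 'h)"
  assumes "unital_operator_algebra A e"
    and "cstar_algebra_on A op_scale mul star"
  shows "\<exists>u\<in>A. \<exists>p.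
      adjoint_op u o\<^sub>L u = e \<and> u o\<^sub>L adjoint_op u = e \<and>
      central_projection (commutant (commutant A)) p \<and>
      (\<forall>a\<in>A. \<forall>b\<in>A.
         mul a b = (p o\<^sub>L a o\<^sub>L u o\<^sub>L b) + ((e - p) o\<^sub>L b o\<^sub>L u o\<^sub>L a)) \<and>
      (\<forall>a\<in>A. star a = adjoint_op u o\<^sub>L adjoint_op a o\<^sub>L adjoint_op u)"
proof -
  interpret second_structure A e mul star
    using assms by (simp add: second_structure_def operator_algebra_def cstar_structure_def)
  show ?thesis by (rule decomposition)
qed

end
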